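(* One has $T^-(H_5)=M(H_5)$ and $M(W_5)=T^+(W_5)$; thus each of the two bounds $T^-(G)\leq M(G)$ and $M(G)\leq T^+(G)$, valid for all finite simple graphs $G$, is attained with equality by some graph.
   Context: Graphs are finite and simple. For a real symmetric $n\times n$ matrix $A=[a_{ij}]$, the graph of $A$ is the simple graph on vertices $1,\ldots,n$ where $\{i,j\}$ ($i\neq j$) is an edge if and only if $a_{ij}\neq 0$ (the diagonal entries are unrestricted). For a graph $G$ on $n$ vertices, $S(G)$ is the set of all $n\times n$ real symmetric matrices whose graph is $G$, and $M(G)$ is the maximum multiplicity of an eigenvalue of a matrix in $S(G)$; equivalently $M(G)=\max_{A\in S(G)}\operatorname{nullity}(A)$. The path cover number $P(G)$ is the minimum number of vertex-disjoint paths, each occurring as an induced subgraph of $G$, that cover all the vertices of $G$ (a single vertex counts as a path; the graph with no vertices has path cover number $0$). For a set $S$ of vertices of $G$, $G\setminus S$ is the induced subgraph obtained by deleting $S$. Define $$T^-(G)=\max\{P(G\setminus S)-|S| : S\subseteq V(G),\ G\setminus S \text{ is a forest}\},$$ $$T^+(G)=\min\{P(G\setminus S)+|S| : S\subseteq V(G),\ G\setminus S \text{ is a forest}\}.$$ $W_n$ ($n\geq 4$) is the wheel on $n$ vertices: a cycle $C_{n-1}$ together with one further vertex adjacent to all vertices of the cycle. $H_n$ ($n\geq 3$) is the $n$-sun: the graph on $2n$ vertices obtained from the cycle $C_n$ by attaching exactly one pendant vertex to each vertex of the cycle. *)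

theory Defs
  imports
    "Graph_Theory.Pair_Digraph"
    "Jordan_Normal_Form.Char_Poly"
    "HOL-Library.Disjoint_Sets"
begin

text \<open>
  Finite simple graphs are the symmetric loop-free finite digraphs of \<^locale>\<open>pair_graph\<close>:
  an edge \<open>{u, v}\<close> is present as the two arcs \<open>(u, v)\<close> and \<open>(v, u)\<close>.
\<close>

definition delete_verts :: "'a pair_pre_digraph \<Rightarrow> 'a set \<Rightarrow> 'a pair_pre_digraph" where
  "delete_verts G S =
     \<lparr>pverts = pverts G - S, parcs = {(u, v) \<in> parcs G. u \<notin> S \<and> v \<notin> S}\<rparr>"

text \<open>
  The bound on the length is essential: as a closed arc walk, every edge \<open>{u, v}\<close> gives the
  directed cycle \<open>u, v, u\<close>. The library predicate \<open>forest\<close>, which has no such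
  bound, is therefore not the forest notion for undirected graphs.
\<close>

definition is_forest :: "'a pair_pre_digraph \<Rightarrow> bool" where
  "is_forest G \<longleftrightarrow> \<not> (\<exists>p. pre_digraph.cycle (with_proj G) p \<and> 3 \<le> length p)"

text \<open>The subgraph of \<open>G\<close> induced by \<open>W\<close> is a path.\<close>

definition induces_path :: "'a pair_pre_digraph \<Rightarrow> 'a set \<Rightarrow> bool" where
  "induces_path G W \<longleftrightarrow>
     (\<exists>xs. xs \<noteq> [] \<and> distinct xs \<and> set xs = W \<and>
        (\<forall>i < length xs. \<forall>j < length xs.
           (xs ! i, xs ! j) \<in> parcs G \<longleftrightarrow> j = Suc i \<or> i = Suc j))"

definition path_cover :: "'a pair_pre_digraph \<Rightarrow> 'a set set \<Rightarrow> bool" where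
  "path_cover G C \<longleftrightarrow> partition_on (pverts G) C \<and> (\<forall>W \<in> C. induces_path G W)"

definition path_cover_number :: "'a pair_pre_digraph \<Rightarrow> nat" where
  "path_cover_number G = Min {card C | C. path_cover G C}"

text \<open>
  The \<open>n \<times> n\<close> real symmetric matrices whose graph is \<open>G\<close>. Rows and columns are indexed by
  \<open>0, \<dots>, n - 1\<close>, and the vertices of \<open>G\<close> may be numbered in any way by a bijection \<open>f\<close>;
  renumbering is a simultaneous permutation of rows and columns and does not affect eigenvalues.
\<close>

definition symmetric_mats :: "'a pair_pre_digraph \<Rightarrow> real mat set" where
  "symmetric_mats G =
     {A. A \<in> carrier_mat (card (pverts G)) (card (pverts G)) \<and> transpose_mat A = A \<and>
        (\<exists>f. bij_betw f {..<card (pverts G)} (pverts G) \<and>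
           (\<forall>i < card (pverts G). \<forall>j < card (pverts G). i \<noteq> j \<longrightarrow>
              (A $$ (i, j) \<noteq> 0 \<longleftrightarrow> (f i, f j) \<in> parcs G)))}"

text \<open>
  A real \<open>\<mu>\<close> that is not an eigenvalue of \<open>A\<close> contributes \<open>0\<close>; this changes nothing when \<open>G\<close>
  has a vertex and gives the graph without vertices the value \<open>0\<close>.
\<close>

definition max_multiplicity :: "'a pair_pre_digraph \<Rightarrow> nat" where
  "max_multiplicity G = Max {order \<mu> (char_poly A) | \<mu> A. A \<in> symmetric_mats G}"

definition T_minus :: "'a pair_pre_digraph \<Rightarrow> int" where
  "T_minus G = Max {int (path_cover_number (delete_verts G S)) - int (card S) | S.
     S \<subseteq> pverts G \<and> is_forest (delete_verts G S)}"

definition T_plus :: "'a pair_pre_digraph \<Rightarrow> int" where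
  "T_plus G = Min {int (path_cover_number (delete_verts G S)) + int (card S) | S.
     S \<subseteq> pverts G \<and> is_forest (delete_verts G S)}"

text \<open>The cycle on \<open>0, \<dots>, n - 1\<close>, for \<open>n \<ge> 3\<close>.\<close>

definition cycle_arcs :: "nat \<Rightarrow> (nat \<times> nat) set" where
  "cycle_arcs n = {(i, j). i < n \<and> j < n \<and> (j = Suc i mod n \<or> i = Suc j mod n)}"

text \<open>For \<open>n \<ge> 4\<close>; the hub is the vertex \<open>n - 1\<close>.\<close>

definition wheel :: "nat \<Rightarrow> nat pair_pre_digraph" where
  "wheel n =
     \<lparr>pverts = {..<n},
      parcs = cycle_arcs (n - 1) \<union>
        {(i, n - 1) | i. i < n - 1} \<union> {(n - 1, i) | i. i < n - 1}\<rparr>"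

text \<open>For \<open>n \<ge> 3\<close>; the pendant vertex at \<open>i < n\<close> is \<open>n + i\<close>.\<close>

definition sun :: "nat \<Rightarrow> nat pair_pre_digraph" where
  "sun n =
     \<lparr>pverts = {..<2 * n},
      parcs = cycle_arcs n \<union> {(i, n + i) | i. i < n} \<union> {(n + i, i) | i. i < n}\<rparr>"

end

theory Submission
  imports Defs "Jordan_Normal_Form.Schur_Decomposition"
begin

text \<open>
  Everything is expressed through kernels of symmetric weight functions on the vertices. For a
  real symmetric matrix the order of \<open>\<mu>\<close> as a root of the characteristic polynomial is the dimension
  of the eigenspace (\<open>le_order_iff_eigenspace_dim_ge\<close>), and the diagonal of a matrix with a given graph
  is free, so \<open>\<mu>\<close> may be shifted to \<open>0\<close>: the maximum multiplicity is the largest nullity of a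
  symmetric weighting of the graph (\<open>le_max_multiplicity_iff\<close>). That a kernel has dimension at least
  \<open>k\<close> is encoded as: fewer than \<open>k\<close> linear conditions never force a kernel vector to vanish. All the
  constructions below transform linear conditions in an evident way, so no bases are needed.

  \<^bold>\<open>Upper bound.\<close> Let \<open>G \<setminus> S\<close> be a forest covered by induced paths, and let a kernel vector vanish on
  \<open>S\<close> and at the first vertex of each path. Then it vanishes everywhere. Otherwise take, on every path
  that is not yet cleared, the last vertex \<open>v\<close> before the first nonzero entry. The equation at \<open>v\<close>
  needs a second nonzero neighbour of \<open>v\<close>, which lies beyond the corresponding vertex of another path.
  Walking from there back along that path and then jumping again gives an endless walk that never
  turns back on itself, impossible in a forest (\<open>kernel_vector_forced_to_zero\<close>). Hence the nullity is
  at most the number of paths plus \<open>card S\<close>.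

  \<^bold>\<open>Lower bound.\<close> For a forest some weighting has nullity at least the path cover number
  (\<open>forest_nullity_path_cover_number\<close>), by induction. A forest with an edge has either a leaf whose
  neighbour has degree at most \<open>2\<close>, or a vertex with two leaf neighbours. In the first case
  deleting the leaf does not lower the path cover number, and putting it back need not lower the
  nullity. In the second case deleting the common neighbour raises the path cover number by at least
  one, since its two leaves become isolated and can be rejoined through it, while putting it back
  costs at most one dimension of the kernel. Likewise, putting a deleted set \<open>S\<close> back costs at most \<open>card S\<close> dimensions.

  \<^bold>\<open>Equality.\<close> For the \<open>5\<close>-sun, deleting one cycle vertex leaves a forest with five vertices of degree at
  most one, hence needing three paths, so \<open>T_minus\<close> is at least \<open>2\<close>; and two coordinates on the cycle,
  chosen according to which pendant diagonal entries vanish, determine a kernel vector, so the nullity is at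
  most \<open>2\<close>. For the wheel on five vertices, deleting two opposite rim vertices leaves a path, so \<open>T_plus\<close>
  is at most \<open>3\<close>, and there is a weighting of rank two, so the nullity \<open>3\<close> is attained.
\<close>

section \<open>Eigenspaces and the characteristic polynomial\<close>


text \<open>
  A subspace has dimension at least \<open>k\<close> iff it meets the common kernel of any fewer than \<open>k\<close> linear
  functionals nontrivially. This form transports along linear maps without choosing bases.
\<close>

definition eigenspace_dim_ge :: "real mat \<Rightarrow> nat \<Rightarrow> real \<Rightarrow> nat \<Rightarrow> bool" where
  "eigenspace_dim_ge A n \<mu> k \<longleftrightarrow>
     (\<forall>\<Phi>. finite \<Phi> \<and> \<Phi> \<subseteq> carrier_vec n \<and> card \<Phi> < k \<longrightarrow>
        (\<exists>x \<in> carrier_vec n. x \<noteq> 0\<^sub>v n \<and> A *\<^sub>v x = \<mu> \<cdot>\<^sub>v x \<and> (\<forall>\<phi> \<in> \<Phi>. \<phi> \<bullet> x = 0)))"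

text \<open>
  Completing \<open>v\<close> to an orthogonal basis makes \<open>A\<close> similar to a block upper triangular matrix with the
  \<open>1 \<times> 1\<close> corner \<open>\<mu>\<close>. The matrix \<open>P\<close> is the change of basis, and \<open>D\<close> the action of \<open>A\<close> on the
  quotient by the line through \<open>v\<close>.
\<close>

lemma eigenvector_deflation:
  fixes A :: "real mat"
  assumes A: "A \<in> carrier_mat (Suc n) (Suc n)" and v: "v \<in> carrier_vec (Suc n)"
    and v0: "v \<noteq> 0\<^sub>v (Suc n)" and ev: "A *\<^sub>v v = \<mu> \<cdot>\<^sub>v v"
  obtains P Q b D where "P \<in> carrier_mat (Suc n) (Suc n)" "Q \<in> carrier_mat (Suc n) (Suc n)"
    "P * Q = 1\<^sub>m (Suc n)" "Q * P = 1\<^sub>m (Suc n)" "b \<in> carrier_vec n" "D \<in> carrier_mat n n"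
    "char_poly A = [:- \<mu>, 1:] * char_poly D"
    "\<And>a w. w \<in> carrier_vec n \<Longrightarrow>
       A *\<^sub>v (P *\<^sub>v vCons a w) = P *\<^sub>v vCons (\<mu> * a + b \<bullet> w) (D *\<^sub>v w)"
proof -
  interpret cof_vec_space "Suc n" "TYPE(real)" .
  define bs where "bs = basis_completion v"
  note bc = basis_completion[OF v v0, folded bs_def]
  define ws where "ws = gram_schmidt (Suc n) bs"
  define W where "W = mat_of_cols (Suc n) ws"
  define W' where "W' = corthogonal_inv W"
  define A' where "A' = W' * A * W"
  from bc obtain vs where bv: "bs = v # vs" by (cases bs) auto
  from gram_schmidt_result[OF bc(2) bc(4) bc(5) refl, folded ws_def]
  have ws: "set ws \<subseteq> carrier_vec (Suc n)" "corthogonal ws" "length ws = Suc n"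
    using bc by auto
  have hdws: "hd ws = v"
    unfolding ws_def bv using gram_schmidt_hd[OF v] .
  have orth_W: "corthogonal_mat W"
    unfolding W_def using orthogonal_mat_of_cols ws by blast
  have W: "W \<in> carrier_mat (Suc n) (Suc n)"
    using ws unfolding W_def using mat_of_cols_carrier(1)[of "Suc n" ws] by auto
  have W': "W' \<in> carrier_mat (Suc n) (Suc n)"
    unfolding W'_def corthogonal_inv_def using W by (auto simp: mat_of_rows_def)
  have "inverts_mat W' W"
    unfolding W'_def by (rule corthogonal_inv_result[OF orth_W])
  then have W'W: "W' * W = 1\<^sub>m (Suc n)"
    using W W' unfolding inverts_mat_def by auto
  have WW': "W * W' = 1\<^sub>m (Suc n)"
    using mat_mult_left_right_inverse[OF W' W W'W] .
  have A': "A' \<in> carrier_mat (Suc n) (Suc n)" using W W' A unfolding A'_def by auto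
  have sim: "similar_mat A' A"
    unfolding similar_mat_def
    by (rule exI[of _ W'], rule exI[of _ W], rule similar_mat_witI[of _ _ "Suc n"])
      (use W W' A A' W'W WW' in \<open>auto simp: A'_def\<close>)
  have col0: "col A' 0 = vec (Suc n) (\<lambda>i. if i = 0 then \<mu> else 0)"
    unfolding A'_def W'_def W_def
    using corthogonal_col_ev_0[OF A v v0 ev _ hdws ws] by auto
  define b where "b = vec n (\<lambda>j. A' $$ (0, Suc j))"
  define D where "D = mat n n (\<lambda>(i, j). A' $$ (Suc i, Suc j))"
  have A'0: "A' $$ (i, 0) = (if i = 0 then \<mu> else 0)" if "i < Suc n" for i
    using arg_cong[OF col0, of "\<lambda>v. v $ i"] that A' by (auto simp: col_def)
  have block: "A' = four_block_mat (mat 1 1 (\<lambda>_. \<mu>)) (mat 1 n (\<lambda>(i, j). b $ j)) (0\<^sub>m n 1) D"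
    by (rule eq_matI) (use A' A'0 in \<open>auto simp: D_def b_def\<close>)
  have "char_poly A' = char_poly (mat 1 1 (\<lambda>_. \<mu>)) * char_poly D"
    unfolding block by (rule char_poly_four_block_zeros_col) (auto simp: D_def)
  also have "char_poly (mat 1 1 (\<lambda>_. \<mu>)) = [:- \<mu>, 1:]"
    by (simp add: char_poly_defs det_def sign_def)
  finally have cp: "char_poly A = [:- \<mu>, 1:] * char_poly D"
    using char_poly_similar[OF sim] by simp
  have bl: "A' *\<^sub>v vCons a w = vCons (\<mu> * a + b \<bullet> w) (D *\<^sub>v w)" if w: "w \<in> carrier_vec n" for a w
  proof (rule eq_vecI)
    fix i assume "i < dim_vec (vCons (\<mu> * a + b \<bullet> w) (D *\<^sub>v w))"
    then have i: "i < Suc n" by (simp add: D_def)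
    have row: "row A' i = vCons (if i = 0 then \<mu> else 0) (if i = 0 then b else row D (i - 1))"
      by (rule eq_vecI) (use A' i A'0 in \<open>auto simp: vec_index_vCons b_def D_def\<close>)
    show "(A' *\<^sub>v vCons a w) $ i = vCons (\<mu> * a + b \<bullet> w) (D *\<^sub>v w) $ i"
      using A' i w by (auto simp: row vec_index_vCons D_def)
  qed (use A' w in \<open>auto simp: D_def\<close>)
  have WA': "W * A' = A * W"
    unfolding A'_def using W W' A WW'
    by (smt (verit) assoc_mult_mat left_mult_one_mat mult_carrier_mat)
  have "A *\<^sub>v (W *\<^sub>v vCons a w) = W *\<^sub>v vCons (\<mu> * a + b \<bullet> w) (D *\<^sub>v w)"
    if w: "w \<in> carrier_vec n" for a w
  proof -
    have c: "vCons a w \<in> carrier_vec (Suc n)" using w by simp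
    have "A *\<^sub>v (W *\<^sub>v vCons a w) = (W * A') *\<^sub>v vCons a w"
      unfolding WA' using A W c by simp
    also have "\<dots> = W *\<^sub>v (A' *\<^sub>v vCons a w)" using W A' c by simp
    finally show ?thesis using bl[OF w] by simp
  qed
  with W W' WW' W'W cp show ?thesis
    by (intro that[of W W' b D]) (auto simp: b_def D_def)
qed

lemma vec_eq_vConsD: "x \<in> carrier_vec (Suc n) \<Longrightarrow> \<exists>a w. x = vCons a w \<and> w \<in> carrier_vec n"
  by (cases x) auto

lemma order_char_poly_deflation:
  fixes D :: "real mat"
  assumes cp: "char_poly A = [:- \<mu>, 1:] * char_poly D" and D: "D \<in> carrier_mat n n"
  shows "Polynomial.order \<mu> (char_poly A) = Suc (Polynomial.order \<mu> (char_poly D))"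
proof -
  have "char_poly D \<noteq> 0" using degree_monic_char_poly[OF D] by auto
  then have "[:- \<mu>, 1:] * char_poly D \<noteq> 0"
    by (metis mult_eq_0_iff pCons_eq_0_iff zero_neq_one)
  then have "Polynomial.order \<mu> ([:- \<mu>, 1:] * char_poly D) = Polynomial.order \<mu> [:- \<mu>, 1:] + Polynomial.order \<mu> (char_poly D)"
    by (rule order_mult)
  moreover have "Polynomial.order \<mu> [:- \<mu>, 1:] = 1"
    using order_power_n_n[of \<mu> 1] by simp
  ultimately show ?thesis unfolding cp by simp
qed

text \<open>
  The second hypothesis says that \<open>A - \<mu>\<close> and its square have the same kernel, so that \<open>\<mu>\<close> has only
  Jordan blocks of size one. Unlike symmetry, this property survives passing to the quotient by an
  eigenvector, which makes an induction along \<open>eigenvector_deflation\<close> possible: each step lowers both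
  the order of the root and the dimension of the eigenspace by one.
\<close>

lemma le_order_iff_eigenspace_dim_ge:
  fixes A :: "real mat"
  assumes "A \<in> carrier_mat n n"
    and "\<And>x. x \<in> carrier_vec n \<Longrightarrow>
      A *\<^sub>v (A *\<^sub>v x - \<mu> \<cdot>\<^sub>v x) = \<mu> \<cdot>\<^sub>v (A *\<^sub>v x - \<mu> \<cdot>\<^sub>v x) \<Longrightarrow> A *\<^sub>v x = \<mu> \<cdot>\<^sub>v x"
  shows "k \<le> Polynomial.order \<mu> (char_poly A) \<longleftrightarrow> eigenspace_dim_ge A n \<mu> k"
  using assms
proof (induction k arbitrary: A n)
  case 0
  show ?case by (simp add: eigenspace_dim_ge_def)
next
  case (Suc k)
  note A = Suc.prems(1) and semi = Suc.prems(2)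
  show ?case
  proof (cases "\<exists>v \<in> carrier_vec n. v \<noteq> 0\<^sub>v n \<and> A *\<^sub>v v = \<mu> \<cdot>\<^sub>v v")
    case False
    have "\<not> eigenspace_dim_ge A n \<mu> (Suc k)"
      using False unfolding eigenspace_dim_ge_def by (auto intro!: exI[of _ "{}"])
    moreover have "Polynomial.order \<mu> (char_poly A) = 0"
    proof (rule order_0I)
      have "\<not> eigenvalue A \<mu>"
        using False A unfolding eigenvalue_def eigenvector_def by auto
      then show "poly (char_poly A) \<mu> \<noteq> 0" using eigenvalue_root_char_poly[OF A] by simp
    qed
    ultimately show ?thesis by simp
  next
    case True
    then obtain v where v: "v \<in> carrier_vec n" "v \<noteq> 0\<^sub>v n" "A *\<^sub>v v = \<mu> \<cdot>\<^sub>v v" by blast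
    from v obtain m where n: "n = Suc m" by (cases n) auto
    obtain P Q b D where P: "P \<in> carrier_mat (Suc m) (Suc m)" and Q: "Q \<in> carrier_mat (Suc m) (Suc m)"
      and PQ: "P * Q = 1\<^sub>m (Suc m)" and QP: "Q * P = 1\<^sub>m (Suc m)" and b: "b \<in> carrier_vec m"
      and D: "D \<in> carrier_mat m m" and cp: "char_poly A = [:- \<mu>, 1:] * char_poly D"
      and AP: "\<And>a w. w \<in> carrier_vec m \<Longrightarrow>
       A *\<^sub>v (P *\<^sub>v vCons a w) = P *\<^sub>v vCons (\<mu> * a + b \<bullet> w) (D *\<^sub>v w)"
      using eigenvector_deflation[of A m v \<mu>] A v unfolding n by metis
    have QPx: "Q *\<^sub>v (P *\<^sub>v x) = x" if "x \<in> carrier_vec (Suc m)" for x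
      using assoc_mult_mat_vec[OF Q P that] QP that by simp
    have PQx: "P *\<^sub>v (Q *\<^sub>v x) = x" if "x \<in> carrier_vec (Suc m)" for x
      using assoc_mult_mat_vec[OF P Q that] PQ that by simp
    have Pc: "P *\<^sub>v x \<in> carrier_vec (Suc m)" for x using P by (intro carrier_vecI) simp
    have Pinj: "x = y" if "P *\<^sub>v x = P *\<^sub>v y" "x \<in> carrier_vec (Suc m)" "y \<in> carrier_vec (Suc m)" for x y
      using QPx that by metis
    have Dc: "D *\<^sub>v w \<in> carrier_vec m" for w using D by (intro carrier_vecI) simp
    have res: "A *\<^sub>v (P *\<^sub>v vCons a w) - \<mu> \<cdot>\<^sub>v (P *\<^sub>v vCons a w) = P *\<^sub>v vCons (b \<bullet> w) (D *\<^sub>v w - \<mu> \<cdot>\<^sub>v w)"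
      if w: "w \<in> carrier_vec m" for a w
    proof -
      have "A *\<^sub>v (P *\<^sub>v vCons a w) - \<mu> \<cdot>\<^sub>v (P *\<^sub>v vCons a w)
          = P *\<^sub>v vCons (\<mu> * a + b \<bullet> w) (D *\<^sub>v w) - P *\<^sub>v (\<mu> \<cdot>\<^sub>v vCons a w)"
        using AP[OF w] mult_mat_vec[OF P, of "vCons a w"] w by simp
      also have "\<dots> = P *\<^sub>v (vCons (\<mu> * a + b \<bullet> w) (D *\<^sub>v w) - \<mu> \<cdot>\<^sub>v vCons a w)"
        by (rule mult_minus_distrib_mat_vec[symmetric, OF P]) (use w Dc in auto)
      also have "vCons (\<mu> * a + b \<bullet> w) (D *\<^sub>v w) - \<mu> \<cdot>\<^sub>v vCons a w = vCons (b \<bullet> w) (D *\<^sub>v w - \<mu> \<cdot>\<^sub>v w)"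
        by (rule eq_vecI) (use w D in \<open>auto simp: vec_index_vCons\<close>)
      finally show ?thesis .
    qed
    have eqv: "y = \<mu> \<cdot>\<^sub>v x \<longleftrightarrow> y - \<mu> \<cdot>\<^sub>v x = 0\<^sub>v l"
      if "x \<in> carrier_vec l" "y \<in> carrier_vec l" for x y :: "real vec" and l
    proof
      assume "y - \<mu> \<cdot>\<^sub>v x = 0\<^sub>v l"
      then have "\<And>i. i < l \<Longrightarrow> y $ i - \<mu> * x $ i = 0"
        using that by (metis carrier_vecD index_minus_vec(1) index_smult_vec(1) index_smult_vec(2) index_zero_vec(1))
      then show "y = \<mu> \<cdot>\<^sub>v x" using that by (intro eq_vecI) auto
    qed (use that in auto)
    have P0: "P *\<^sub>v 0\<^sub>v (Suc m) = 0\<^sub>v (Suc m)" using P by auto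
    \<comment> \<open>Every eigenvector of the quotient lifts: the lift is killed by the square of \<open>A - \<mu>\<close>.\<close>
    have semi': "A *\<^sub>v (P *\<^sub>v vCons a w) = \<mu> \<cdot>\<^sub>v (P *\<^sub>v vCons a w)"
      if w: "w \<in> carrier_vec m" and "D *\<^sub>v w = \<mu> \<cdot>\<^sub>v w" for a w
    proof -
      have "D *\<^sub>v w - \<mu> \<cdot>\<^sub>v w = 0\<^sub>v m" using that by auto
      then have y: "A *\<^sub>v (P *\<^sub>v vCons a w) - \<mu> \<cdot>\<^sub>v (P *\<^sub>v vCons a w) = P *\<^sub>v vCons (b \<bullet> w) (0\<^sub>v m)"
        using res[OF w] by simp
      have "A *\<^sub>v (P *\<^sub>v vCons (b \<bullet> w) (0\<^sub>v m)) - \<mu> \<cdot>\<^sub>v (P *\<^sub>v vCons (b \<bullet> w) (0\<^sub>v m)) = 0\<^sub>v (Suc m)"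
      proof -
        have "D *\<^sub>v 0\<^sub>v m - \<mu> \<cdot>\<^sub>v 0\<^sub>v m = 0\<^sub>v m" using D by auto
        moreover have "b \<bullet> 0\<^sub>v m = 0" using b by simp
        ultimately show ?thesis
          using res[of "0\<^sub>v m" "b \<bullet> w"] P0 by (simp add: zero_vec_Suc)
      qed
      then have "A *\<^sub>v (P *\<^sub>v vCons (b \<bullet> w) (0\<^sub>v m)) = \<mu> \<cdot>\<^sub>v (P *\<^sub>v vCons (b \<bullet> w) (0\<^sub>v m))"
        using eqv[of "P *\<^sub>v vCons (b \<bullet> w) (0\<^sub>v m)" "Suc m"] Pc A n by auto
      then show ?thesis using semi[of "P *\<^sub>v vCons a w"] Pc y n by simp
    qed
    have semiD: "D *\<^sub>v x = \<mu> \<cdot>\<^sub>v x" if x: "x \<in> carrier_vec m"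
      and "D *\<^sub>v (D *\<^sub>v x - \<mu> \<cdot>\<^sub>v x) = \<mu> \<cdot>\<^sub>v (D *\<^sub>v x - \<mu> \<cdot>\<^sub>v x)" for x
    proof -
      let ?r = "D *\<^sub>v x - \<mu> \<cdot>\<^sub>v x"
      have r: "?r \<in> carrier_vec m" using x D by auto
      have "A *\<^sub>v (P *\<^sub>v vCons 0 x) = \<mu> \<cdot>\<^sub>v (P *\<^sub>v vCons 0 x)"
        using semi[of "P *\<^sub>v vCons 0 x"] semi'[OF r that(2)] res[OF x] Pc n by simp
      then have "P *\<^sub>v vCons (b \<bullet> x) ?r = P *\<^sub>v 0\<^sub>v (Suc m)"
        using res[OF x, of 0] minus_cancel_vec[of "\<mu> \<cdot>\<^sub>v (P *\<^sub>v vCons 0 x)" "Suc m"]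
          Pc[of "vCons 0 x"] P0 by (metis smult_carrier_vec)
      then have "?r = 0\<^sub>v m"
        using Pinj[of "vCons (b \<bullet> x) ?r" "0\<^sub>v (Suc m)"] r by (simp add: zero_vec_Suc)
      then show ?thesis using eqv[of x m "D *\<^sub>v x"] x Dc by simp
    qed
    have IH: "k \<le> Polynomial.order \<mu> (char_poly D) \<longleftrightarrow> eigenspace_dim_ge D m \<mu> k"
      by (rule Suc.IH[OF D semiD])
    have ord: "Suc k \<le> Polynomial.order \<mu> (char_poly A) \<longleftrightarrow> eigenspace_dim_ge D m \<mu> k"
      using order_char_poly_deflation[OF cp D] IH by simp
    \<comment> \<open>\<open>g \<phi>\<close> is the functional \<open>\<phi>\<close> in the new coordinates, with first coordinate \<open>g0\<close> and remaining
      part \<open>gt\<close>.\<close>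
    define g where "g = (\<lambda>\<phi>. transpose_mat P *\<^sub>v \<phi>)"
    have gc: "g \<phi> \<in> carrier_vec (Suc m)" for \<phi> unfolding g_def using P by (intro carrier_vecI) simp
    have g: "\<phi> \<bullet> (P *\<^sub>v x) = g \<phi> \<bullet> x" if "\<phi> \<in> carrier_vec (Suc m)" "x \<in> carrier_vec (Suc m)" for \<phi> x
      unfolding g_def using transpose_vec_mult_scalar[OF P that(2,1)] by simp
    define g0 where "g0 = (\<lambda>\<phi>. g \<phi> $ 0)"
    define gt where "gt = (\<lambda>\<phi>. vec m (\<lambda>j. g \<phi> $ Suc j))"
    have gtc: "gt \<phi> \<in> carrier_vec m" for \<phi> by (simp add: gt_def)
    have gv: "g \<phi> = vCons (g0 \<phi>) (gt \<phi>)" for \<phi>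
      by (rule eq_vecI) (use gc[of \<phi>] in \<open>auto simp: g0_def gt_def vec_index_vCons\<close>)
    have g': "\<phi> \<bullet> (P *\<^sub>v vCons a w) = g0 \<phi> * a + gt \<phi> \<bullet> w"
      if "\<phi> \<in> carrier_vec (Suc m)" "w \<in> carrier_vec m" for \<phi> a w
      using g[of \<phi> "vCons a w"] that by (simp add: gv)
    have "eigenspace_dim_ge A n \<mu> (Suc k) \<longleftrightarrow> eigenspace_dim_ge D m \<mu> k"
    proof
      assume L: "eigenspace_dim_ge A n \<mu> (Suc k)"
      show "eigenspace_dim_ge D m \<mu> k"
        unfolding eigenspace_dim_ge_def
      proof (intro allI impI, elim conjE)
        fix \<Phi> :: "real vec set"
        assume fin: "finite \<Phi>" and sub: "\<Phi> \<subseteq> carrier_vec m" and card: "card \<Phi> < k"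
        define h where "h = (\<lambda>\<phi>. transpose_mat Q *\<^sub>v vCons 0 \<phi>)"
        \<comment> \<open>The extra functional \<open>row Q 0\<close> excludes multiples of \<open>v\<close>, which vanish in the quotient.\<close>
        define \<Psi> where "\<Psi> = insert (row Q 0) (h ` \<Phi>)"
        have "card \<Psi> \<le> Suc (card \<Phi>)"
        proof -
          have "card \<Psi> \<le> Suc (card (h ` \<Phi>))"
            unfolding \<Psi>_def using fin by (simp add: card_insert_if)
          then show ?thesis using card_image_le[OF fin, of h] by simp
        qed
        moreover have "\<Psi> \<subseteq> carrier_vec n" "finite \<Psi>"
          using Q fin by (auto simp: \<Psi>_def h_def n intro!: carrier_vecI)
        ultimately have "finite \<Psi> \<and> \<Psi> \<subseteq> carrier_vec n \<and> card \<Psi> < Suc k"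
          using card by simp
        then obtain x where x: "x \<in> carrier_vec n" "x \<noteq> 0\<^sub>v n" "A *\<^sub>v x = \<mu> \<cdot>\<^sub>v x"
          "\<forall>\<psi> \<in> \<Psi>. \<psi> \<bullet> x = 0"
          using L[unfolded eigenspace_dim_ge_def, rule_format, of \<Psi>] by blast
        have "Q *\<^sub>v x \<in> carrier_vec (Suc m)" using Q by (intro carrier_vecI) simp
        then obtain a w where aw: "Q *\<^sub>v x = vCons a w" and w: "w \<in> carrier_vec m"
          using vec_eq_vConsD by blast
        have "a = row Q 0 \<bullet> x" using arg_cong[OF aw, of "\<lambda>v. v $ 0"] Q by simp
        then have a: "a = 0" using x(4) by (simp add: \<Psi>_def)
        have xP: "x = P *\<^sub>v vCons 0 w" using PQx[of x] aw x(1) a n by simp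
        have w0: "w \<noteq> 0\<^sub>v m"
          using x(2) xP P0 by (auto simp: n zero_vec_Suc)
        have "P *\<^sub>v vCons (b \<bullet> w) (D *\<^sub>v w - \<mu> \<cdot>\<^sub>v w) = P *\<^sub>v 0\<^sub>v (Suc m)"
          using res[OF w, of 0] x(1,3) P0 unfolding xP[symmetric] by (simp add: n)
        then have "D *\<^sub>v w - \<mu> \<cdot>\<^sub>v w = 0\<^sub>v m"
          using Pinj[of "vCons (b \<bullet> w) (D *\<^sub>v w - \<mu> \<cdot>\<^sub>v w)" "0\<^sub>v (Suc m)"] w Dc[of w]
          by (simp add: zero_vec_Suc)
        then have Dw: "D *\<^sub>v w = \<mu> \<cdot>\<^sub>v w" using eqv[of w m "D *\<^sub>v w"] w Dc by simp
        have "\<phi> \<bullet> w = 0" if "\<phi> \<in> \<Phi>" for \<phi>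
        proof -
          have p: "\<phi> \<in> carrier_vec m" using that sub by auto
          have "h \<phi> \<bullet> x = vCons 0 \<phi> \<bullet> (Q *\<^sub>v x)"
            unfolding h_def using transpose_vec_mult_scalar[OF Q, of x "vCons 0 \<phi>"] x(1) p n by simp
          then show ?thesis using x(4) that by (simp add: \<Psi>_def aw)
        qed
        then show "\<exists>x\<in>carrier_vec m. x \<noteq> 0\<^sub>v m \<and> D *\<^sub>v x = \<mu> \<cdot>\<^sub>v x \<and> (\<forall>\<phi>\<in>\<Phi>. \<phi> \<bullet> x = 0)"
          using w w0 Dw by blast
      qed
    next
      assume R: "eigenspace_dim_ge D m \<mu> k"
      show "eigenspace_dim_ge A n \<mu> (Suc k)"
        unfolding eigenspace_dim_ge_def
      proof (intro allI impI, elim conjE)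
        fix \<Phi> :: "real vec set"
        assume fin: "finite \<Phi>" and sub: "\<Phi> \<subseteq> carrier_vec n" and card: "card \<Phi> < Suc k"
        show "\<exists>x\<in>carrier_vec n. x \<noteq> 0\<^sub>v n \<and> A *\<^sub>v x = \<mu> \<cdot>\<^sub>v x \<and> (\<forall>\<phi>\<in>\<Phi>. \<phi> \<bullet> x = 0)"
        proof (cases "\<forall>\<phi> \<in> \<Phi>. g0 \<phi> = 0")
          case True
          have D0: "D *\<^sub>v 0\<^sub>v m = \<mu> \<cdot>\<^sub>v 0\<^sub>v m" using D by auto
          have "P *\<^sub>v vCons 1 (0\<^sub>v m) \<noteq> 0\<^sub>v n"
            using Pinj[of "vCons 1 (0\<^sub>v m)" "0\<^sub>v (Suc m)"] P0 by (auto simp: n zero_vec_Suc)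
          moreover have "\<phi> \<bullet> (P *\<^sub>v vCons 1 (0\<^sub>v m)) = 0" if "\<phi> \<in> \<Phi>" for \<phi>
            using g'[of \<phi> "0\<^sub>v m" 1] True that sub gtc[of \<phi>] by (auto simp: n)
          ultimately show ?thesis
            using semi'[OF _ D0, of 1] Pc n by (intro bexI[of _ "P *\<^sub>v vCons 1 (0\<^sub>v m)"]) auto
        next
          case False
          then obtain \<phi>0 where \<phi>0: "\<phi>0 \<in> \<Phi>" "g0 \<phi>0 \<noteq> 0" by blast
          \<comment> \<open>Eliminating the eigenvector coordinate with the help of \<open>\<phi>0\<close> uses up one functional.\<close>
          define h where "h = (\<lambda>\<phi>. gt \<phi> - (g0 \<phi> / g0 \<phi>0) \<cdot>\<^sub>v gt \<phi>0)"
          have "card (h ` (\<Phi> - {\<phi>0})) \<le> card (\<Phi> - {\<phi>0})"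
            using fin by (simp add: card_image_le)
          also have "\<dots> < k" using card \<phi>0 fin card_Diff_singleton[of \<phi>0 \<Phi>] card_gt_0_iff[of \<Phi>] by auto
          finally have "card (h ` (\<Phi> - {\<phi>0})) < k" .
          moreover have "h ` (\<Phi> - {\<phi>0}) \<subseteq> carrier_vec m" using gtc by (auto simp: h_def)
          moreover have "finite (h ` (\<Phi> - {\<phi>0}))" using fin by simp
          ultimately have "\<exists>w \<in> carrier_vec m. w \<noteq> 0\<^sub>v m \<and> D *\<^sub>v w = \<mu> \<cdot>\<^sub>v w \<and>
              (\<forall>\<psi> \<in> h ` (\<Phi> - {\<phi>0}). \<psi> \<bullet> w = 0)"
            using R[unfolded eigenspace_dim_ge_def, rule_format, of "h ` (\<Phi> - {\<phi>0})"] by blast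
          then obtain w where w: "w \<in> carrier_vec m" "w \<noteq> 0\<^sub>v m" "D *\<^sub>v w = \<mu> \<cdot>\<^sub>v w"
            "\<forall>\<psi> \<in> h ` (\<Phi> - {\<phi>0}). \<psi> \<bullet> w = 0"
            by blast
          define a where "a = - (gt \<phi>0 \<bullet> w) / g0 \<phi>0"
          have "P *\<^sub>v vCons a w \<noteq> 0\<^sub>v n"
            using Pinj[of "vCons a w" "0\<^sub>v (Suc m)"] P0 w by (auto simp: n zero_vec_Suc)
          moreover have "\<phi> \<bullet> (P *\<^sub>v vCons a w) = 0" if "\<phi> \<in> \<Phi>" for \<phi>
          proof (cases "\<phi> = \<phi>0")
            case True
            then show ?thesis using g'[of \<phi> w a] that sub w \<phi>0 by (auto simp: n a_def)
          next
            case False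
            then have "h \<phi> \<bullet> w = 0" using w that by auto
            then have "gt \<phi> \<bullet> w = (g0 \<phi> / g0 \<phi>0) * (gt \<phi>0 \<bullet> w)"
              unfolding h_def using gtc[of \<phi>] gtc[of \<phi>0] w(1)
              by (subst (asm) minus_scalar_prod_distrib[of _ m]) auto
            then show ?thesis using g'[of \<phi> w a] that sub w by (auto simp: n a_def)
          qed
          ultimately show ?thesis
            using semi'[OF w(1,3), of a] Pc n by (intro bexI[of _ "P *\<^sub>v vCons a w"]) auto
        qed
      qed
    qed
    with ord show ?thesis by simp
  qed
qed

text \<open>
  With \<open>r = A x - \<mu> x\<close> one has \<open>r \<bullet> r = (A r - \<mu> r) \<bullet> x = 0\<close>.
\<close>

lemma symmetric_semisimple:
  fixes A :: "real mat"
  assumes A: "A \<in> carrier_mat n n" and sym: "transpose_mat A = A" and x: "x \<in> carrier_vec n"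
    and y: "A *\<^sub>v (A *\<^sub>v x - \<mu> \<cdot>\<^sub>v x) = \<mu> \<cdot>\<^sub>v (A *\<^sub>v x - \<mu> \<cdot>\<^sub>v x)"
  shows "A *\<^sub>v x = \<mu> \<cdot>\<^sub>v x"
proof -
  define r where "r = A *\<^sub>v x - \<mu> \<cdot>\<^sub>v x"
  have r: "r \<in> carrier_vec n" using A x by (simp add: r_def)
  have Ax: "A *\<^sub>v x \<in> carrier_vec n" using A by (intro carrier_vecI) simp
  have "r \<bullet> r = r \<bullet> (A *\<^sub>v x) - \<mu> * (r \<bullet> x)"
    using r Ax x scalar_prod_minus_distrib[OF r Ax, of "\<mu> \<cdot>\<^sub>v x"] by (simp flip: r_def)
  also have "r \<bullet> (A *\<^sub>v x) = \<mu> * (r \<bullet> x)"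
    using transpose_vec_mult_scalar[OF A x r] y sym r x by (simp flip: r_def)
  finally have "r = 0\<^sub>v n"
    using conjugate_square_eq_0_vec[OF r] r by (simp add: scalar_prod_def)
  then have "\<And>i. i < n \<Longrightarrow> (A *\<^sub>v x) $ i - \<mu> * x $ i = 0"
    using x Ax unfolding r_def
    by (metis carrier_vecD index_minus_vec(1) index_smult_vec(1) index_smult_vec(2) index_zero_vec(1))
  then show ?thesis using x Ax A by (intro eq_vecI) auto
qed


section \<open>Multiplicity as nullity of a weighting\<close>


definition weighting :: "'a pair_pre_digraph \<Rightarrow> ('a \<Rightarrow> 'a \<Rightarrow> real) \<Rightarrow> bool" where
  "weighting G w \<longleftrightarrow> (\<forall>u \<in> pverts G. \<forall>v \<in> pverts G.
     w u v = w v u \<and> (u \<noteq> v \<longrightarrow> (w u v \<noteq> 0 \<longleftrightarrow> (u, v) \<in> parcs G)))"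

text \<open>
  The vertex-indexed counterpart of \<open>eigenspace_dim_ge\<close> for the eigenvalue \<open>0\<close>.
\<close>

definition nullity_ge :: "'a set \<Rightarrow> ('a \<Rightarrow> 'a \<Rightarrow> real) \<Rightarrow> nat \<Rightarrow> bool" where
  "nullity_ge V w k \<longleftrightarrow> (\<forall>\<Phi>. finite \<Phi> \<and> card \<Phi> < k \<longrightarrow>
     (\<exists>x. (\<exists>v \<in> V. x v \<noteq> 0) \<and> (\<forall>u \<in> V. (\<Sum>v\<in>V. w u v * x v) = 0) \<and>
        (\<forall>\<phi> \<in> \<Phi>. (\<Sum>v\<in>V. \<phi> v * x v) = 0)))"

lemma nullity_geD:
  assumes "nullity_ge V w k" "finite \<Phi>" "card \<Phi> < k"
  obtains x where "\<exists>v \<in> V. x v \<noteq> 0" "\<And>u. u \<in> V \<Longrightarrow> (\<Sum>v\<in>V. w u v * x v) = 0"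
    "\<And>\<phi>. \<phi> \<in> \<Phi> \<Longrightarrow> (\<Sum>v\<in>V. \<phi> v * x v) = 0"
  using assms(1)[unfolded nullity_ge_def, rule_format, of \<Phi>] assms(2,3) that by blast

lemma nullity_geI:
  assumes "\<And>\<Phi>. finite \<Phi> \<Longrightarrow> card \<Phi> < k \<Longrightarrow>
     \<exists>x. (\<exists>v \<in> V. x v \<noteq> 0) \<and> (\<forall>u \<in> V. (\<Sum>v\<in>V. w u v * x v) = 0) \<and>
        (\<forall>\<phi> \<in> \<Phi>. (\<Sum>v\<in>V. \<phi> v * x v) = 0)"
  shows "nullity_ge V w k"
  unfolding nullity_ge_def by (intro allI impI, elim conjE) (rule assms)

lemma eigenspace_dim_ge_iff_nullity_ge:
  assumes f: "bij_betw f {..<n} V" and A: "A \<in> carrier_mat n n"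
    and Aw: "\<And>i j. i < n \<Longrightarrow> j < n \<Longrightarrow> A $$ (i, j) = w (f i) (f j) + (if i = j then \<mu> else 0)"
  shows "eigenspace_dim_ge A n \<mu> k \<longleftrightarrow> nullity_ge V w k"
proof -
  define g where "g = inv_into {..<n} f"
  have gf: "g (f i) = i" if "i < n" for i
    using that f unfolding g_def bij_betw_def by (simp add: inv_into_f_f)
  have V: "V = f ` {..<n}" using f by (simp add: bij_betw_def)
  have sumV: "(\<Sum>v\<in>V. h v) = (\<Sum>i<n. h (f i))" for h :: "'a \<Rightarrow> real"
    using sum.reindex_bij_betw[OF f, of h] by simp
  have R1: "x \<noteq> 0\<^sub>v n \<longleftrightarrow> (\<exists>v \<in> V. y v \<noteq> 0)"
    if "x \<in> carrier_vec n" "\<forall>i<n. y (f i) = x $ i" for x :: "real vec" and y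
  proof -
    have "x = 0\<^sub>v n \<longleftrightarrow> (\<forall>i<n. x $ i = 0)" using that(1) by (auto intro!: eq_vecI)
    then show ?thesis using that(2) by (auto simp: V)
  qed
  have R2: "A *\<^sub>v x = \<mu> \<cdot>\<^sub>v x \<longleftrightarrow> (\<forall>u \<in> V. (\<Sum>v\<in>V. w u v * y v) = 0)"
    if x: "x \<in> carrier_vec n" and y: "\<forall>i<n. y (f i) = x $ i" for x y
  proof -
    have "(A *\<^sub>v x) $ i = (\<Sum>v\<in>V. w (f i) v * y v) + \<mu> * x $ i" if i: "i < n" for i
    proof -
      have "(A *\<^sub>v x) $ i = (\<Sum>j<n. A $$ (i, j) * x $ j)"
        using A x i by (simp add: scalar_prod_def lessThan_atLeast0)
      also have "\<dots> = (\<Sum>j<n. w (f i) (f j) * y (f j) + (if i = j then \<mu> * x $ j else 0))"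
        by (intro sum.cong) (use Aw i y in \<open>auto simp: algebra_simps\<close>)
      finally show ?thesis using i by (simp add: sum.distrib sumV)
    qed
    moreover have "A *\<^sub>v x = \<mu> \<cdot>\<^sub>v x \<longleftrightarrow> (\<forall>i<n. (A *\<^sub>v x) $ i = \<mu> * x $ i)"
    proof
      assume "A *\<^sub>v x = \<mu> \<cdot>\<^sub>v x"
      then show "\<forall>i<n. (A *\<^sub>v x) $ i = \<mu> * x $ i" using x by simp
    next
      assume "\<forall>i<n. (A *\<^sub>v x) $ i = \<mu> * x $ i"
      then show "A *\<^sub>v x = \<mu> \<cdot>\<^sub>v x" using x A by (intro eq_vecI) auto
    qed
    ultimately show ?thesis by (auto simp: V)
  qed
  have R3: "\<phi> \<bullet> x = (\<Sum>v\<in>V. \<psi> v * y v)"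
    if "x \<in> carrier_vec n" "\<forall>i<n. y (f i) = x $ i" "\<forall>i<n. \<psi> (f i) = \<phi> $ i"
    for x \<phi> :: "real vec" and y \<psi>
    using that unfolding scalar_prod_def sumV by (auto simp: lessThan_atLeast0 intro!: sum.cong)
  show ?thesis
  proof
    assume E: "eigenspace_dim_ge A n \<mu> k"
    show "nullity_ge V w k"
    proof (rule nullity_geI)
      fix \<Phi> :: "('a \<Rightarrow> real) set" assume fin: "finite \<Phi>" and card: "card \<Phi> < k"
      let ?v = "\<lambda>\<phi>. vec n (\<lambda>i. \<phi> (f i))"
      have "card (?v ` \<Phi>) < k" using card card_image_le[OF fin, of ?v] by simp
      then have "finite (?v ` \<Phi>) \<and> ?v ` \<Phi> \<subseteq> carrier_vec n \<and> card (?v ` \<Phi>) < k"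
        using fin by auto
      then obtain x where x: "x \<in> carrier_vec n" "x \<noteq> 0\<^sub>v n" "A *\<^sub>v x = \<mu> \<cdot>\<^sub>v x"
        "\<forall>\<psi> \<in> ?v ` \<Phi>. \<psi> \<bullet> x = 0"
        using E[unfolded eigenspace_dim_ge_def, rule_format, of "?v ` \<Phi>"] by blast
      define y where "y = (\<lambda>v. x $ g v)"
      have y: "\<forall>i<n. y (f i) = x $ i" by (simp add: y_def gf)
      have "(\<Sum>v\<in>V. \<phi> v * y v) = 0" if "\<phi> \<in> \<Phi>" for \<phi>
        using R3[OF x(1) y, of \<phi> "?v \<phi>"] x(4) that by simp
      then show "\<exists>x. (\<exists>v \<in> V. x v \<noteq> 0) \<and> (\<forall>u \<in> V. (\<Sum>v\<in>V. w u v * x v) = 0) \<and>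
        (\<forall>\<phi> \<in> \<Phi>. (\<Sum>v\<in>V. \<phi> v * x v) = 0)"
        using R1[OF x(1) y] R2[OF x(1) y] x by blast
    qed
  next
    assume N: "nullity_ge V w k"
    show "eigenspace_dim_ge A n \<mu> k"
      unfolding eigenspace_dim_ge_def
    proof (intro allI impI, elim conjE)
      fix \<Phi> :: "real vec set"
      assume fin: "finite \<Phi>" and sub: "\<Phi> \<subseteq> carrier_vec n" and card: "card \<Phi> < k"
      let ?f = "\<lambda>\<phi> v. \<phi> $ g v"
      have "card (?f ` \<Phi>) < k" using card card_image_le[OF fin, of ?f] by simp
      then obtain y where y: "\<exists>v \<in> V. y v \<noteq> 0" "\<And>u. u \<in> V \<Longrightarrow> (\<Sum>v\<in>V. w u v * y v) = 0"
        "\<And>\<phi>. \<phi> \<in> ?f ` \<Phi> \<Longrightarrow> (\<Sum>v\<in>V. \<phi> v * y v) = 0"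
        using nullity_geD[OF N, of "?f ` \<Phi>"] fin by blast
      define x where "x = vec n (\<lambda>i. y (f i))"
      have x: "x \<in> carrier_vec n" "\<forall>i<n. y (f i) = x $ i" by (simp_all add: x_def)
      have "\<phi> \<bullet> x = 0" if "\<phi> \<in> \<Phi>" for \<phi>
        using R3[OF x, of "?f \<phi>" \<phi>] y(3) that by (simp add: gf)
      then show "\<exists>x\<in>carrier_vec n. x \<noteq> 0\<^sub>v n \<and> A *\<^sub>v x = \<mu> \<cdot>\<^sub>v x \<and> (\<forall>\<phi>\<in>\<Phi>. \<phi> \<bullet> x = 0)"
        using R1[OF x] R2[OF x] x(1) y(1,2) by blast
    qed
  qed
qed

lemma le_order_iff_nullity_ge:
  assumes f: "bij_betw f {..<n} V" and A: "A \<in> carrier_mat n n" and sym: "transpose_mat A = A"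
    and Aw: "\<And>i j. i < n \<Longrightarrow> j < n \<Longrightarrow> A $$ (i, j) = w (f i) (f j) + (if i = j then \<mu> else 0)"
  shows "k \<le> Polynomial.order \<mu> (char_poly A) \<longleftrightarrow> nullity_ge V w k"
  using le_order_iff_eigenspace_dim_ge[OF A symmetric_semisimple[OF A sym]]
    eigenspace_dim_ge_iff_nullity_ge[OF f A Aw] by metis

text \<open>
  The eigenvalue can be taken to be \<open>0\<close> because subtracting a multiple of the identity changes only
  the unrestricted diagonal.
\<close>

lemma le_max_multiplicity_iff:
  fixes G :: "'a pair_pre_digraph"
  assumes fin: "finite (pverts G)" and symG: "\<And>u v. (u, v) \<in> parcs G \<Longrightarrow> (v, u) \<in> parcs G"
  shows "k \<le> max_multiplicity G \<longleftrightarrow> (\<exists>w. weighting G w \<and> nullity_ge (pverts G) w k)"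
proof -
  define n where "n = card (pverts G)"
  define X where "X = {Polynomial.order \<mu> (char_poly A) | \<mu> A. A \<in> symmetric_mats G}"
  have M: "max_multiplicity G = Max X"
    by (simp add: max_multiplicity_def X_def)
  obtain f0 where f0: "bij_betw f0 {..<n} (pverts G)"
    using ex_bij_betw_nat_finite[OF fin] by (auto simp: n_def lessThan_atLeast0)
  have ofw: "\<exists>A \<in> symmetric_mats G. \<forall>k. k \<le> Polynomial.order 0 (char_poly A) \<longleftrightarrow> nullity_ge (pverts G) w k"
    if w: "weighting G w" for w
  proof -
    define A where "A = mat n n (\<lambda>(i, j). w (f0 i) (f0 j))"
    have A: "A \<in> carrier_mat n n" by (simp add: A_def)
    have inV: "f0 i \<in> pverts G" if "i < n" for i using f0 that by (auto simp: bij_betw_def)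
    have inj: "f0 i = f0 j \<longleftrightarrow> i = j" if "i < n" "j < n" for i j
      using f0 that by (auto simp: bij_betw_def inj_on_def)
    have sym: "transpose_mat A = A"
      by (rule eq_matI) (use w inV in \<open>auto simp: A_def weighting_def\<close>)
    have "A \<in> symmetric_mats G"
      unfolding symmetric_mats_def
      using A sym f0 w inV inj by (auto simp: n_def[symmetric] A_def weighting_def intro!: exI[of _ f0])
    moreover have "k \<le> Polynomial.order 0 (char_poly A) \<longleftrightarrow> nullity_ge (pverts G) w k" for k
      by (rule le_order_iff_nullity_ge[OF f0 A sym]) (simp add: A_def)
    ultimately show ?thesis by blast
  qed
  have toW: "\<exists>w. weighting G w \<and> (\<forall>k. k \<le> Polynomial.order \<mu> (char_poly A) \<longleftrightarrow> nullity_ge (pverts G) w k)"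
    if AS: "A \<in> symmetric_mats G" for A \<mu>
  proof -
    from AS obtain f where A: "A \<in> carrier_mat n n" and sym: "transpose_mat A = A"
      and f: "bij_betw f {..<n} (pverts G)"
      and pat: "\<And>i j. i < n \<Longrightarrow> j < n \<Longrightarrow> i \<noteq> j \<Longrightarrow> A $$ (i, j) \<noteq> 0 \<longleftrightarrow> (f i, f j) \<in> parcs G"
      unfolding symmetric_mats_def n_def by blast
    define g where "g = inv_into {..<n} f"
    have gf: "g (f i) = i" if "i < n" for i
      using that f unfolding g_def bij_betw_def by (simp add: inv_into_f_f)
    have V: "pverts G = f ` {..<n}" using f by (simp add: bij_betw_def)
    have Asym: "A $$ (i, j) = A $$ (j, i)" if "i < n" "j < n" for i j
      using arg_cong[OF sym, of "\<lambda>B. B $$ (i, j)"] that A by simp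
    define w where "w = (\<lambda>u v. A $$ (g u, g v) - (if u = v then \<mu> else 0))"
    have inj: "f i = f j \<longleftrightarrow> i = j" if "i < n" "j < n" for i j
      using f that by (auto simp: bij_betw_def inj_on_def)
    have "weighting G w"
      unfolding weighting_def V w_def using Asym pat inj by (auto simp: gf)
    moreover have "k \<le> Polynomial.order \<mu> (char_poly A) \<longleftrightarrow> nullity_ge (pverts G) w k" for k
      by (rule le_order_iff_nullity_ge[OF f A sym]) (use inj in \<open>auto simp: w_def gf\<close>)
    ultimately show ?thesis by blast
  qed
  have "finite X"
  proof (rule finite_subset)
    show "X \<subseteq> {..n}"
    proof
      fix m assume "m \<in> X"
      then obtain \<mu> A where m: "m = Polynomial.order \<mu> (char_poly A)" and AS: "A \<in> symmetric_mats G"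
        unfolding X_def by blast
      then have A: "A \<in> carrier_mat n n" by (simp add: symmetric_mats_def n_def)
      have "monic (char_poly A)" "degree (char_poly A) = n" using degree_monic_char_poly[OF A] by auto
      moreover from this have "char_poly A \<noteq> 0" by (metis leading_coeff_0_iff zero_neq_one)
      ultimately show "m \<in> {..n}" using order_degree[of "char_poly A" \<mu>] m by auto
    qed
  qed simp
  moreover have "X \<noteq> {}"
  proof -
    have "weighting G (\<lambda>u v. if (u, v) \<in> parcs G then 1 else 0)"
      using symG by (auto simp: weighting_def)
    then show ?thesis using ofw unfolding X_def by blast
  qed
  ultimately have iff: "k \<le> max_multiplicity G \<longleftrightarrow> (\<exists>m \<in> X. k \<le> m)"
    unfolding M by (rule Max_ge_iff)
  show ?thesis
  proof
    assume "k \<le> max_multiplicity G"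
    then obtain \<mu> A where A: "A \<in> symmetric_mats G" and k: "k \<le> Polynomial.order \<mu> (char_poly A)"
      unfolding iff X_def by blast
    from toW[OF A, of \<mu>] k show "\<exists>w. weighting G w \<and> nullity_ge (pverts G) w k" by metis
  next
    assume "\<exists>w. weighting G w \<and> nullity_ge (pverts G) w k"
    then obtain w where w: "weighting G w" "nullity_ge (pverts G) w k" by blast
    from ofw[OF w(1)] obtain A where "A \<in> symmetric_mats G" "k \<le> Polynomial.order 0 (char_poly A)"
      using w(2) by metis
    then show "k \<le> max_multiplicity G" unfolding iff X_def by blast
  qed
qed

lemma underdetermined_system:
  fixes \<Phi> :: "('a \<Rightarrow> real) set"
  assumes "finite \<Phi>" "finite V" "card \<Phi> < card V"
  shows "\<exists>x. (\<exists>v \<in> V. x v \<noteq> 0) \<and> (\<forall>\<phi> \<in> \<Phi>. (\<Sum>v\<in>V. \<phi> v * x v) = 0)"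
  using assms
proof (induction "card \<Phi>" arbitrary: \<Phi> V rule: less_induct)
  case less
  show ?case
  proof (cases "\<exists>\<phi>0 \<in> \<Phi>. \<exists>v0 \<in> V. \<phi>0 v0 \<noteq> 0")
    case False
    obtain v where "v \<in> V" using less.prems by (metis card.empty ex_in_conv not_less_zero)
    then show ?thesis using False by (intro exI[of _ "\<lambda>_. 1"]) auto
  next
    case True
    then obtain \<phi>0 v0 where p: "\<phi>0 \<in> \<Phi>" "v0 \<in> V" "\<phi>0 v0 \<noteq> 0" by blast
    define h where "h = (\<lambda>\<psi> v. \<psi> v - \<psi> v0 / \<phi>0 v0 * \<phi>0 v)"
    define \<Psi> where "\<Psi> = h ` (\<Phi> - {\<phi>0})"
    have c: "card \<Psi> \<le> card \<Phi> - 1"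
      unfolding \<Psi>_def using card_image_le[of "\<Phi> - {\<phi>0}" h] less.prems p by simp
    have pos: "card \<Phi> > 0" using p less.prems card_gt_0_iff by blast
    have "card (V - {v0}) = card V - 1" using p less.prems by simp
    then obtain x where x: "\<exists>v \<in> V - {v0}. x v \<noteq> 0" "\<forall>\<psi> \<in> \<Psi>. (\<Sum>v\<in>V - {v0}. \<psi> v * x v) = 0"
    proof -
      have "card \<Psi> < card \<Phi>" "finite \<Psi>" "finite (V - {v0})" "card \<Psi> < card (V - {v0})"
        using c pos less.prems \<open>card (V - {v0}) = card V - 1\<close> by (auto simp: \<Psi>_def)
      from less.hyps[OF this] show ?thesis using that by blast
    qed
    define c0 where "c0 = - (\<Sum>v\<in>V - {v0}. \<phi>0 v * x v) / \<phi>0 v0"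
    define y where "y = x(v0 := c0)"
    have S: "(\<Sum>v\<in>V. \<psi> v * y v) = \<psi> v0 * c0 + (\<Sum>v\<in>V - {v0}. \<psi> v * x v)" for \<psi>
    proof -
      have "(\<Sum>v\<in>V - {v0}. \<psi> v * y v) = (\<Sum>v\<in>V - {v0}. \<psi> v * x v)"
        by (intro sum.cong) (auto simp: y_def)
      then show ?thesis using sum.remove[OF less.prems(2) p(2), of "\<lambda>v. \<psi> v * y v"] by (simp add: y_def)
    qed
    have "(\<Sum>v\<in>V. \<psi> v * y v) = 0" if "\<psi> \<in> \<Phi>" for \<psi>
    proof (cases "\<psi> = \<phi>0")
      case True
      then show ?thesis using S p by (simp add: c0_def)
    next
      case False
      then have "(\<Sum>v\<in>V - {v0}. h \<psi> v * x v) = 0" using x that by (auto simp: \<Psi>_def)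
      then have "(\<Sum>v\<in>V - {v0}. \<psi> v * x v) = \<psi> v0 / \<phi>0 v0 * (\<Sum>v\<in>V - {v0}. \<phi>0 v * x v)"
        by (simp add: h_def left_diff_distrib sum_subtractf sum_distrib_left mult.assoc)
      then show ?thesis using S by (simp add: c0_def)
    qed
    moreover have "\<exists>v\<in>V. y v \<noteq> 0" using x(1) by (auto simp: y_def)
    ultimately show ?thesis by blast
  qed
qed


section \<open>Graphs, cycles and forests\<close>


lemma pair_graph_iff:
  "pair_graph G \<longleftrightarrow> finite (pverts G) \<and>
     (\<forall>u v. (u, v) \<in> parcs G \<longrightarrow> u \<in> pverts G \<and> v \<in> pverts G \<and> u \<noteq> v \<and> (v, u) \<in> parcs G)"
  (is "?L \<longleftrightarrow> ?R")
proof
  assume ?L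
  then interpret pair_graph G .
  have "(v, u) \<in> parcs G" if "(u, v) \<in> parcs G" for u v
    using arcs_symmetric[of u v] that by simp
  moreover have "u \<noteq> v" if "(u, v) \<in> parcs G" for u v
    using no_loops[of "(u, v)"] that by simp
  ultimately show ?R
    using finite_verts in_arcsD1 in_arcsD2 by auto
next
  assume R: ?R
  have "parcs G \<subseteq> pverts G \<times> pverts G" using R by auto
  then have "finite (parcs G)" using R finite_subset by blast
  then show ?L
    using R by unfold_locales (auto simp: symmetric_def sym_def)
qed

lemma pair_graphD:
  assumes "pair_graph G"
  shows "finite (pverts G)" "(u, v) \<in> parcs G \<Longrightarrow> u \<in> pverts G"
    "(u, v) \<in> parcs G \<Longrightarrow> v \<in> pverts G" "(u, v) \<in> parcs G \<Longrightarrow> (v, u) \<in> parcs G"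
    "(u, u) \<notin> parcs G"
  using assms unfolding pair_graph_iff by blast+

lemma delete_verts_simps [simp]:
  "pverts (delete_verts G S) = pverts G - S"
  "(u, v) \<in> parcs (delete_verts G S) \<longleftrightarrow> (u, v) \<in> parcs G \<and> u \<notin> S \<and> v \<notin> S"
  by (auto simp: delete_verts_def)

lemma pair_graph_delete_verts: "pair_graph G \<Longrightarrow> pair_graph (delete_verts G S)"
  unfolding pair_graph_iff by auto

text \<open>
  Vertex lists are easier to build and to inspect than the arc walks behind \<open>is_forest\<close>; the two
  notions are matched in \<open>is_forest_iff_no_cycle_list\<close>.
\<close>

definition cycle_list :: "'a pair_pre_digraph \<Rightarrow> 'a list \<Rightarrow> bool" where
  "cycle_list G xs \<longleftrightarrow> 3 \<le> length xs \<and> distinct xs \<and>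
     (\<forall>i < length xs. (xs ! i, xs ! (Suc i mod length xs)) \<in> parcs G)"

lemma pcas_iff:
  assumes "p \<noteq> []"
  shows "pcas u p v \<longleftrightarrow> fst (hd p) = u \<and> snd (last p) = v \<and>
    (\<forall>i. Suc i < length p \<longrightarrow> snd (p ! i) = fst (p ! Suc i))"
  using assms
proof (induction p arbitrary: u)
  case (Cons e es)
  show ?case
  proof (cases "es = []")
    case False
    have "(\<forall>i. Suc i < length (e # es) \<longrightarrow> snd ((e # es) ! i) = fst ((e # es) ! Suc i)) \<longleftrightarrow>
      snd e = fst (hd es) \<and> (\<forall>i. Suc i < length es \<longrightarrow> snd (es ! i) = fst (es ! Suc i))"
      (is "?L \<longleftrightarrow> ?R")
    proof
      assume L: ?L
      then have "snd e = fst (hd es)" using False by (force simp: hd_conv_nth dest: spec[of _ 0])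
      moreover have "snd (es ! i) = fst (es ! Suc i)" if "Suc i < length es" for i
        using L[rule_format, of "Suc i"] that by simp
      ultimately show ?R by blast
    next
      assume R: ?R
      show ?L
      proof (intro allI impI)
        fix i assume "Suc i < length (e # es)"
        then show "snd ((e # es) ! i) = fst ((e # es) ! Suc i)"
          using R False by (cases i) (auto simp: hd_conv_nth)
      qed
    qed
    then show ?thesis using Cons.IH[OF False] False by auto
  qed simp
qed simp

lemma pawalk_verts_pcas: "pcas u p v \<Longrightarrow> pawalk_verts u p = u # map snd p"
  by (induction p arbitrary: u) auto

lemma is_forest_iff_no_cycle_list:
  assumes "pair_graph G"
  shows "is_forest G \<longleftrightarrow> \<not> (\<exists>xs. cycle_list G xs)"
proof -
  interpret pair_graph G by (rule assms)
  have "(\<exists>p. pre_digraph.cycle (with_proj G) p \<and> 3 \<le> length p) \<longleftrightarrow> (\<exists>xs. cycle_list G xs)"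
  proof (intro iffI; elim exE conjE)
    fix p assume c: "pre_digraph.cycle (with_proj G) p" and len: "3 \<le> length p"
    then obtain u where aw: "set p \<subseteq> parcs G" "pcas u p u" and dist: "distinct (tl (pawalk_verts u p))"
      unfolding cycle_def awalk_def by auto
    from len have ne: "p \<noteq> []" by auto
    note pc = aw(2)[unfolded pcas_iff[OF ne]]
    have "snd (p ! i) = fst (p ! (Suc i mod length p))" if "i < length p" for i
    proof (cases "Suc i < length p")
      case False
      then have "Suc i = length p" using that by simp
      then show ?thesis using pc ne by (metis diff_Suc_1 hd_conv_nth last_conv_nth mod_self)
    qed (use pc in simp)
    moreover have "p ! (Suc i mod length p) \<in> parcs G" for i
      using aw(1) ne by (meson length_greater_0_conv mod_less_divisor nth_mem subsetD)
    ultimately have "(snd (p ! i), snd (p ! (Suc i mod length p))) \<in> parcs G" if "i < length p" for i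
      using that by (metis prod.collapse)
    then have "cycle_list G (map snd p)"
      unfolding cycle_list_def using len dist pawalk_verts_pcas[OF aw(2)] ne by simp
    then show "\<exists>xs. cycle_list G xs" by blast
  next
    fix xs assume xs: "cycle_list G xs"
    define n where "n = length xs"
    have n: "3 \<le> n" and dist: "distinct xs"
      and arc: "\<And>i. i < n \<Longrightarrow> (xs ! i, xs ! (Suc i mod n)) \<in> parcs G"
      using xs unfolding cycle_list_def n_def by auto
    define p where "p = map (\<lambda>i. (xs ! i, xs ! (Suc i mod n))) [0..<n]"
    have len: "length p = n" by (simp add: p_def)
    with n have ne: "p \<noteq> []" by auto
    have "pcas (xs ! 0) p (xs ! 0)"
      unfolding pcas_iff[OF ne] using n
      by (auto simp: p_def hd_conv_nth last_conv_nth)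
    moreover have "map snd p = rotate1 xs"
      by (rule nth_equalityI) (auto simp: p_def n_def nth_rotate1)
    moreover have "set p \<subseteq> parcs G" using arc by (auto simp: p_def)
    moreover have "xs ! 0 \<in> pverts G" using arc[of 0] n in_arcsD1 by auto
    ultimately have "pre_digraph.cycle (with_proj G) p"
      unfolding cycle_def awalk_def using pawalk_verts_pcas[of "xs ! 0" p "xs ! 0"] dist ne
      by (intro exI[of _ "xs ! 0"]) auto
    then show "\<exists>p. pre_digraph.cycle (with_proj G) p \<and> 3 \<le> length p" using len n by auto
  qed
  then show ?thesis unfolding is_forest_def by simp
qed

lemma is_forest_delete_verts:
  assumes "pair_graph G" "is_forest G"
  shows "is_forest (delete_verts G S)"
  using assms(2) unfolding is_forest_iff_no_cycle_list[OF assms(1)]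
    is_forest_iff_no_cycle_list[OF pair_graph_delete_verts[OF assms(1)]] cycle_list_def
  by auto

text \<open>
  In a finite graph such a walk revisits a vertex. The shortest stretch between two visits of the same
  vertex has no repetition inside, and it has length at least \<open>3\<close> because there are no loops and no immediate
  reversals, so it is a cycle.
\<close>

lemma nonbacktracking_walk_not_forest:
  assumes G: "pair_graph G" and arc: "\<And>n. (x n, x (Suc n)) \<in> parcs G"
    and nb: "\<And>n. x (Suc (Suc n)) \<noteq> x n"
  shows "\<not> is_forest G"
proof -
  define R where "R = (\<lambda>d. 0 < d \<and> (\<exists>i. x i = x (i + d)))"
  have "finite (range x)"
    by (rule finite_subset[OF _ pair_graphD(1)[OF G]]) (use arc pair_graphD(2)[OF G] in blast)
  then have "\<not> inj x" using range_inj_infinite by blast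
  then obtain a b where "a \<noteq> b" "x a = x b" by (auto simp: inj_def)
  then have "\<exists>d. R d"
  proof (cases a b rule: linorder_cases)
    case less
    then show ?thesis using \<open>x a = x b\<close> by (intro exI[of _ "b - a"]) (auto simp: R_def intro!: exI[of _ a])
  next
    case greater
    then show ?thesis using \<open>x a = x b\<close> by (intro exI[of _ "a - b"]) (auto simp: R_def intro!: exI[of _ b])
  qed auto
  define d where "d = (LEAST d. R d)"
  have "R d" unfolding d_def using \<open>\<exists>d. R d\<close> by (rule LeastI_ex)
  then obtain i where i: "x i = x (i + d)" and d0: "0 < d" by (auto simp: R_def)
  have min: "\<not> R e" if "e < d" for e using that not_less_Least unfolding d_def by blast
  have "d \<noteq> 1" using i arc[of i] pair_graphD(5)[OF G] by auto
  moreover have "d \<noteq> 2" using i nb[of i] by auto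
  ultimately have d3: "3 \<le> d" using d0 by simp
  define xs where "xs = map (\<lambda>j. x (i + j)) [0..<d]"
  have neq: "x (i + a) \<noteq> x (i + b)" if "a < b" "b < d" for a b
  proof
    assume "x (i + a) = x (i + b)"
    then have "R (b - a)" using that unfolding R_def by (intro conjI exI[of _ "i + a"]) auto
    then show False using min[of "b - a"] that by simp
  qed
  have "distinct xs"
    unfolding xs_def distinct_map
    by (auto simp: inj_on_def) (metis linorder_neqE_nat neq)
  moreover have "(xs ! j, xs ! (Suc j mod d)) \<in> parcs G" if "j < d" for j
  proof (cases "Suc j = d")
    case True
    then show ?thesis using that arc[of "i + j"] i by (auto simp: xs_def)
  next
    case False
    then show ?thesis using that arc[of "i + j"] by (auto simp: xs_def)
  qed
  ultimately have "cycle_list G xs" using d3 by (auto simp: cycle_list_def xs_def)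
  then show ?thesis using is_forest_iff_no_cycle_list[OF G] by blast
qed

text \<open>
  A vertex of least rank on a cycle would have its two neighbours on the cycle, both of no smaller rank.
\<close>

lemma is_forestI_rank:
  fixes r :: "'a \<Rightarrow> nat"
  assumes G: "pair_graph G"
    and r: "\<And>v a b. (v, a) \<in> parcs G \<Longrightarrow> (v, b) \<in> parcs G \<Longrightarrow> r v \<le> r a \<Longrightarrow> r v \<le> r b \<Longrightarrow> a = b"
  shows "is_forest G"
  unfolding is_forest_iff_no_cycle_list[OF G]
proof
  assume "\<exists>xs. cycle_list G xs"
  then obtain xs where xs: "cycle_list G xs" by blast
  define n where "n = length xs"
  have n: "3 \<le> n" and dist: "distinct xs"
    and arc: "\<And>i. i < n \<Longrightarrow> (xs ! i, xs ! (Suc i mod n)) \<in> parcs G"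
    using xs unfolding cycle_list_def n_def by auto
  have "\<exists>i<n. \<forall>j<n. r (xs ! i) \<le> r (xs ! j)"
    using ex_has_least_nat[of "\<lambda>i. i < n" 0 "\<lambda>i. r (xs ! i)"] n by auto
  then obtain i where i: "i < n" and min: "\<And>j. j < n \<Longrightarrow> r (xs ! i) \<le> r (xs ! j)" by blast
  define j where "j = (if i = 0 then n - 1 else i - 1)"
  have j: "j < n" "Suc j mod n = i" using i n by (auto simp: j_def)
  have "(xs ! i, xs ! j) \<in> parcs G" using arc[OF j(1)] j(2) pair_graphD(4)[OF G] by auto
  moreover have "Suc i mod n < n" using n by simp
  ultimately have "xs ! (Suc i mod n) = xs ! j"
    using r[OF arc[OF i]] min j(1) by blast
  then have "Suc i mod n = j"
    using dist \<open>Suc i mod n < n\<close> j(1) by (simp add: nth_eq_iff_index_eq n_def)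
  then show False using i n by (cases "Suc i = n") (auto simp: j_def split: if_splits)
qed

text \<open>
  If neither configuration occurs, let \<open>U\<close> be the set of vertices of degree at least \<open>2\<close>. A vertex of \<open>U\<close>
  next to a leaf has no second leaf neighbour and has degree at least \<open>3\<close>; so in any case it has two neighbours
  in \<open>U\<close>. Hence one can walk inside \<open>U\<close> forever without turning back.
\<close>

lemma forest_peel:
  assumes G: "pair_graph G" and forest: "is_forest G" and ne: "parcs G \<noteq> {}"
  obtains (leaf) a y where "(a, y) \<in> parcs G" "\<And>z. (a, z) \<in> parcs G \<Longrightarrow> z = y"
      "\<And>b c. (y, b) \<in> parcs G \<Longrightarrow> (y, c) \<in> parcs G \<Longrightarrow> b \<noteq> a \<Longrightarrow> c \<noteq> a \<Longrightarrow> b = c"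
  | (cherry) a b y where "a \<noteq> b" "(a, y) \<in> parcs G" "(b, y) \<in> parcs G"
      "\<And>z. (a, z) \<in> parcs G \<Longrightarrow> z = y" "\<And>z. (b, z) \<in> parcs G \<Longrightarrow> z = y"
proof (rule ccontr)
  assume "\<not> thesis"
  note sym = pair_graphD(4)[OF G]
  define L where "L = (\<lambda>a y. (a, y) \<in> parcs G \<and> (\<forall>z. (a, z) \<in> parcs G \<longrightarrow> z = y))"
  have nl: "\<exists>b c. (y, b) \<in> parcs G \<and> (y, c) \<in> parcs G \<and> b \<noteq> a \<and> c \<noteq> a \<and> b \<noteq> c" if "L a y" for a y
    using leaf[of a y] \<open>\<not> thesis\<close> that unfolding L_def by blast
  have nc: "a = b" if "L a y" "L b y" for a b y
    using cherry[of a b y] \<open>\<not> thesis\<close> that unfolding L_def by blast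
  define U where "U = {y. \<exists>b c. (y, b) \<in> parcs G \<and> (y, c) \<in> parcs G \<and> b \<noteq> c}"
  have LU: "L y v \<or> y \<in> U" if "(v, y) \<in> parcs G" for v y
    using sym[OF that] unfolding L_def U_def by blast
  have two: "\<exists>b c. (v, b) \<in> parcs G \<and> (v, c) \<in> parcs G \<and> b \<in> U \<and> c \<in> U \<and> b \<noteq> c" if v: "v \<in> U" for v
  proof (cases "\<exists>a. L a v")
    case True
    then obtain a where a: "L a v" by blast
    from nl[OF a] obtain b c where bc: "(v, b) \<in> parcs G" "(v, c) \<in> parcs G" "b \<noteq> a" "c \<noteq> a" "b \<noteq> c"
      by blast
    then show ?thesis using LU[of v b] LU[of v c] nc[OF a] by blast
  next
    case False
    then show ?thesis using v LU unfolding U_def by blast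
  qed
  obtain x y where "(x, y) \<in> parcs G" using ne by auto
  have "\<exists>x y. (x, y) \<in> parcs G \<and> y \<in> U"
  proof (cases "L x y")
    case True
    then show ?thesis using nl[OF True] \<open>(x, y) \<in> parcs G\<close> unfolding U_def by blast
  next
    case False
    then have "x \<in> U" using \<open>(x, y) \<in> parcs G\<close> unfolding L_def U_def by blast
    then show ?thesis using sym[OF \<open>(x, y) \<in> parcs G\<close>] by blast
  qed
  then obtain x0 y0 where start: "(x0, y0) \<in> parcs G \<and> y0 \<in> U" by blast
  define P where "P = (\<lambda>(n::nat) e. e \<in> parcs G \<and> snd e \<in> U)"
  have "\<exists>f. \<forall>n. P n (f n) \<and> (snd (f n) = fst (f (Suc n)) \<and> snd (f (Suc n)) \<noteq> fst (f n))"
  proof (rule dependent_nat_choice)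
    show "\<exists>e. P 0 e" using start by (auto simp: P_def)
  next
    fix e n assume e: "P n e"
    then obtain z where "(snd e, z) \<in> parcs G" "z \<in> U" "z \<noteq> fst e"
      using two[of "snd e"] unfolding P_def by metis
    then show "\<exists>e'. P (Suc n) e' \<and> (snd e = fst e' \<and> snd e' \<noteq> fst e)"
      by (intro exI[of _ "(snd e, z)"]) (auto simp: P_def)
  qed
  then obtain f where f: "\<And>n. P n (f n)" "\<And>n. snd (f n) = fst (f (Suc n))"
    "\<And>n. snd (f (Suc n)) \<noteq> fst (f n)" by blast
  have "\<not> is_forest G"
  proof (rule nonbacktracking_walk_not_forest[OF G, of "\<lambda>n. fst (f n)"])
    show "(fst (f n), fst (f (Suc n))) \<in> parcs G" for n
      using f(1)[of n] f(2)[of n, symmetric] by (simp add: P_def)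
    show "fst (f (Suc (Suc n))) \<noteq> fst (f n)" for n
      using f(2)[of "Suc n"] f(3)[of n] by simp
  qed
  with forest show False by simp
qed


section \<open>Covers by induced paths\<close>


definition path_list :: "'a pair_pre_digraph \<Rightarrow> 'a list \<Rightarrow> bool" where
  "path_list G xs \<longleftrightarrow> xs \<noteq> [] \<and> distinct xs \<and>
     (\<forall>i < length xs. \<forall>j < length xs. (xs ! i, xs ! j) \<in> parcs G \<longleftrightarrow> j = Suc i \<or> i = Suc j)"

lemma induces_path_iff: "induces_path G W \<longleftrightarrow> (\<exists>xs. path_list G xs \<and> set xs = W)"
  unfolding induces_path_def path_list_def by blast

lemma path_list_arc_iff:
  "path_list G xs \<Longrightarrow> i < length xs \<Longrightarrow> j < length xs \<Longrightarrow>
     (xs ! i, xs ! j) \<in> parcs G \<longleftrightarrow> j = Suc i \<or> i = Suc j"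
  unfolding path_list_def by blast

lemma path_list_rev:
  assumes "path_list G xs"
  shows "path_list G (rev xs)"
  unfolding path_list_def
proof (intro conjI allI impI)
  fix i j assume "i < length (rev xs)" "j < length (rev xs)"
  then show "(rev xs ! i, rev xs ! j) \<in> parcs G \<longleftrightarrow> j = Suc i \<or> i = Suc j"
    using path_list_arc_iff[OF assms, of "length xs - Suc i" "length xs - Suc j"]
    by (auto simp: rev_nth)
qed (use assms in \<open>auto simp: path_list_def\<close>)

lemma path_list_delete_verts:
  "set xs \<inter> S = {} \<Longrightarrow> path_list (delete_verts G S) xs \<longleftrightarrow> path_list G xs"
  unfolding path_list_def by (auto simp: disjoint_iff)

lemma finite_path_covers: "finite (pverts G) \<Longrightarrow> finite {card C | C. path_cover G C}"
proof -
  assume "finite (pverts G)"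
  moreover have "{C. path_cover G C} \<subseteq> Pow (Pow (pverts G))"
    by (auto simp: path_cover_def partition_on_def)
  ultimately have "finite {C. path_cover G C}" by (meson finite_Pow_iff finite_subset)
  then show ?thesis by (simp add: setcompr_eq_image)
qed

lemma path_cover_number_le:
  "finite (pverts G) \<Longrightarrow> path_cover G C \<Longrightarrow> path_cover_number G \<le> card C"
  unfolding path_cover_number_def by (rule Min_le[OF finite_path_covers]) auto

lemma path_cover_number_attained:
  assumes G: "pair_graph G"
  obtains C where "path_cover G C" "card C = path_cover_number G"
proof -
  have "path_cover G ((\<lambda>v. {v}) ` pverts G)"
    unfolding path_cover_def
  proof (intro conjI ballI)
    show "partition_on (pverts G) ((\<lambda>v. {v}) ` pverts G)"
      by (auto simp: partition_on_def disjoint_def)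
  next
    fix W assume "W \<in> (\<lambda>v. {v}) ` pverts G"
    then obtain v where "W = {v}" by blast
    then show "induces_path G W"
      unfolding induces_path_iff path_list_def
      using pair_graphD(5)[OF G] by (intro exI[of _ "[v]"]) auto
  qed
  then have "{card C | C. path_cover G C} \<noteq> {}" by blast
  from Min_in[OF finite_path_covers[OF pair_graphD(1)[OF G]] this] that show ?thesis
    unfolding path_cover_number_def by auto
qed

lemma path_cover_finite: "finite (pverts G) \<Longrightarrow> path_cover G C \<Longrightarrow> finite C"
  unfolding path_cover_def using finite_elements by blast

section \<open>Nullity is at most the size of a path cover\<close>

text \<open>
  The heads of the paths of a cover form a zero forcing set of a forest. The set \<open>Wh\<close> collects the paths that
  carry a nonzero entry, and \<open>p W\<close> is the position just before the first such entry on \<open>W\<close>.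
\<close>

lemma kernel_vector_forced_to_zero:
  assumes G: "pair_graph G" and forest: "is_forest (delete_verts G S)"
    and part: "partition_on (pverts G - S) C"
    and L: "\<And>W. W \<in> C \<Longrightarrow> path_list (delete_verts G S) (L W)" "\<And>W. W \<in> C \<Longrightarrow> set (L W) = W"
    and w: "weighting G w"
    and ker: "\<And>u. u \<in> pverts G \<Longrightarrow> (\<Sum>v\<in>pverts G. w u v * x v) = 0"
    and S0: "\<And>s. s \<in> S \<Longrightarrow> x s = 0"
    and hd0: "\<And>W. W \<in> C \<Longrightarrow> x (hd (L W)) = 0"
  shows "\<forall>v \<in> pverts G. x v = 0"
proof (rule ccontr)
  assume "\<not> (\<forall>v \<in> pverts G. x v = 0)"
  then obtain v0 where v0: "v0 \<in> pverts G" "x v0 \<noteq> 0" by blast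
  let ?F = "delete_verts G S"
  have F: "pair_graph ?F" by (rule pair_graph_delete_verts[OF G])
  have UC: "\<Union>C = pverts G - S" using part by (simp add: partition_on_def)
  have disj: "W \<inter> W' = {}" if "W \<in> C" "W' \<in> C" "W \<noteq> W'" for W W'
    using part that by (auto simp: partition_on_def disjoint_def)
  define Wh where "Wh = {W \<in> C. \<exists>v \<in> W. x v \<noteq> 0}"
  have "\<exists>p. Suc p < length (L W) \<and> x (L W ! Suc p) \<noteq> 0 \<and> (\<forall>i\<le>p. x (L W ! i) = 0)"
    if W: "W \<in> Wh" for W
  proof -
    have WC: "W \<in> C" using W by (simp add: Wh_def)
    have ne: "L W \<noteq> []" using L(1)[OF WC] by (simp add: path_list_def)
    define R where "R = (\<lambda>i. i < length (L W) \<and> x (L W ! i) \<noteq> 0)"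
    obtain v where "v \<in> set (L W)" "x v \<noteq> 0" using W L(2)[OF WC] by (auto simp: Wh_def)
    then have "\<exists>i. R i" by (auto simp: R_def in_set_conv_nth)
    then have m: "R (LEAST i. R i)" by (rule LeastI_ex)
    moreover have "(LEAST i. R i) \<noteq> 0"
      using m hd0[OF WC] hd_conv_nth[OF ne] unfolding R_def by metis
    then obtain p where p: "(LEAST i. R i) = Suc p" by (cases "LEAST i. R i") auto
    moreover have "\<not> R i" if "i \<le> p" for i using not_less_Least[of i R] p that by simp
    ultimately show ?thesis unfolding R_def by (intro exI[of _ p]) auto
  qed
  then have "\<forall>W \<in> Wh. \<exists>p. Suc p < length (L W) \<and> x (L W ! Suc p) \<noteq> 0 \<and> (\<forall>i\<le>p. x (L W ! i) = 0)"
    by blast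
  from bchoice[OF this] obtain p where p0: "\<forall>W \<in> Wh. Suc (p W) < length (L W) \<and>
      x (L W ! Suc (p W)) \<noteq> 0 \<and> (\<forall>i\<le>p W. x (L W ! i) = 0)" ..
  note p = bspec[OF p0, THEN conjunct1] bspec[OF p0, THEN conjunct2, THEN conjunct1]
    bspec[OF p0, THEN conjunct2, THEN conjunct2, rule_format]
  \<comment> \<open>The equation at position \<open>p W\<close> contains the nonzero term of the next vertex on \<open>W\<close>, hence another
    nonzero term; as \<open>W\<close> is an induced path, that one comes from a different path.\<close>
  have leave: "\<exists>W' i. W' \<in> Wh \<and> W' \<noteq> W \<and> p W' < i \<and> i < length (L W') \<and>
      (L W ! p W, L W' ! i) \<in> parcs ?F" if W: "W \<in> Wh" for W
  proof -
    have WC: "W \<in> C" using W by (simp add: Wh_def)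
    define v where "v = L W ! p W"
    define s where "s = L W ! Suc (p W)"
    have vs: "v \<in> W" "s \<in> W" 
      using p(1)[OF W] nth_mem[of "p W" "L W"] nth_mem[of "Suc (p W)" "L W"]
      unfolding L(2)[OF WC] v_def s_def by simp_all
    have v: "v \<in> pverts G" "v \<notin> S" and s: "s \<in> pverts G" using vs WC UC by auto
    have arc: "(v, s) \<in> parcs ?F"
      using path_list_arc_iff[OF L(1)[OF WC]] p(1)[OF W] by (simp add: v_def s_def)
    have "\<exists>u \<in> pverts G - {s}. w v u * x u \<noteq> 0"
    proof (rule ccontr)
      assume "\<not> (\<exists>u \<in> pverts G - {s}. w v u * x u \<noteq> 0)"
      then have "(\<Sum>u\<in>pverts G - {s}. w v u * x u) = 0" by (intro sum.neutral) auto
      then have "w v s * x s = 0"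
        using ker[OF v(1)] sum.remove[OF pair_graphD(1)[OF G] s, of "\<lambda>u. w v u * x u"] by simp
      moreover have "v \<noteq> s" using arc pair_graphD(5)[OF F] by metis
      then have "w v s \<noteq> 0" using w[unfolded weighting_def, rule_format, OF v(1) s] arc by simp
      ultimately show False using p(2)[OF W] by (simp add: s_def)
    qed
    then obtain u where u: "u \<in> pverts G" "u \<noteq> s" "w v u \<noteq> 0" "x u \<noteq> 0" by auto
    have "x v = 0" using p(3)[OF W] by (simp add: v_def)
    then have "u \<noteq> v" using u by auto
    then have "(v, u) \<in> parcs G" using w[unfolded weighting_def, rule_format, OF v(1) u(1)] u by simp
    moreover have "u \<notin> S" using S0 u by auto
    ultimately have vu: "(v, u) \<in> parcs ?F" using v by simp
    obtain W' where W': "W' \<in> C" "u \<in> W'" using UC u \<open>u \<notin> S\<close> by auto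
    then have Wh': "W' \<in> Wh" using u by (auto simp: Wh_def)
    obtain i where i: "i < length (L W')" "L W' ! i = u"
      using W' L(2) by (metis in_set_conv_nth)
    have "W' \<noteq> W"
    proof
      assume "W' = W"
      then have "i = Suc (p W) \<or> p W = Suc i"
        using path_list_arc_iff[OF L(1)[OF WC], of "p W" i] vu i p(1)[OF W] by (simp add: v_def)
      then show False using i u p(3)[OF W, of i] \<open>W' = W\<close> by (auto simp: s_def)
    qed
    moreover have "p W' < i" using p(3)[OF Wh', of i] i u by force
    ultimately show ?thesis using Wh' i vu unfolding v_def by blast
  qed
  \<comment> \<open>The walk visits positions \<open>i\<close> on paths \<open>W\<close>: it descends to \<open>p W\<close> and then jumps to another path,
    strictly beyond the critical position there. At least one descending step therefore separates two
    jumps, and the walk never reverses.\<close>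
  define P where "P = (\<lambda>(n::nat) (W, i). W \<in> Wh \<and> p W \<le> i \<and> i < length (L W))"
  define Q where "Q = (\<lambda>(n::nat) (W, i) (W', i').
    if i = p W then W' \<noteq> W \<and> p W' < i' \<and> (L W ! i, L W' ! i') \<in> parcs ?F else W' = W \<and> i = Suc i')"
  have "\<exists>f. \<forall>n. P n (f n) \<and> Q n (f n) (f (Suc n))"
  proof (rule dependent_nat_choice)
    obtain W where W: "W \<in> C" "v0 \<in> W" using UC v0 S0 by blast
    then have "W \<in> Wh" using v0 by (auto simp: Wh_def)
    then show "\<exists>e. P 0 e" using p(1)[of W] by (intro exI[of _ "(W, p W)"]) (auto simp: P_def)
  next
    fix e n assume e: "P n e"
    obtain W i where Wi: "e = (W, i)" by (cases e)
    show "\<exists>e'. P (Suc n) e' \<and> Q n e e'"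
    proof (cases "i = p W")
      case True
      then show ?thesis using leave[of W] e Wi by (fastforce simp: P_def Q_def)
    next
      case False
      then show ?thesis using e Wi by (intro exI[of _ "(W, i - 1)"]) (auto simp: P_def Q_def)
    qed
  qed
  then obtain f where f: "\<And>n. P n (f n)" "\<And>n. Q n (f n) (f (Suc n))" by blast
  define y where "y = (\<lambda>n. L (fst (f n)) ! snd (f n))"
  have "\<not> is_forest ?F"
  proof (rule nonbacktracking_walk_not_forest[OF F, of y])
    fix n
    obtain W0 i0 W1 i1 W2 i2 where e: "f n = (W0, i0)" "f (Suc n) = (W1, i1)" "f (Suc (Suc n)) = (W2, i2)"
      by (metis surj_pair)
    have inC: "W0 \<in> C" "W1 \<in> C" "W2 \<in> C"
      using f(1)[of n] f(1)[of "Suc n"] f(1)[of "Suc (Suc n)"] by (auto simp: e P_def Wh_def)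
    have inW: "L W0 ! i0 \<in> W0" "L W2 ! i2 \<in> W2"
      using f(1)[of n] f(1)[of "Suc (Suc n)"] nth_mem[of i0 "L W0"] nth_mem[of i2 "L W2"]
      unfolding L(2)[OF inC(1)] L(2)[OF inC(3)] e P_def by simp_all
    note P0 = f(1)[of n, unfolded e P_def, simplified] and P1 = f(1)[of "Suc n", unfolded e P_def, simplified]
    note Q0 = f(2)[of n, unfolded e Q_def, simplified] and Q1 = f(2)[of "Suc n", unfolded e Q_def, simplified]
    show "(y n, y (Suc n)) \<in> parcs ?F"
    proof (cases "i0 = p W0")
      case True
      then show ?thesis using Q0 by (simp add: y_def e)
    next
      case False
      then have "W1 = W0" "i0 = Suc i1" using Q0 by auto
      then show ?thesis
        using path_list_arc_iff[OF L(1)[OF inC(1)], of i0 i1] P0 by (auto simp: y_def e)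
    qed
    show "y (Suc (Suc n)) \<noteq> y n"
    proof (cases "W2 = W0")
      case False
      then show ?thesis using inW disj[OF inC(3,1)] by (auto simp: y_def e)
    next
      case True
      then have "i0 \<noteq> p W0" "i1 \<noteq> p W1" using Q0 Q1 by (auto split: if_splits)
      then have "W1 = W0" "i0 = Suc (Suc i2)" using Q0 Q1 by auto
      moreover have "distinct (L W0)" using L(1)[OF inC(1)] by (simp add: path_list_def)
      ultimately show ?thesis using True P0 by (auto simp: y_def e nth_eq_iff_index_eq)
    qed
  qed
  with forest show False by simp
qed

lemma nullity_le_path_cover:
  assumes G: "pair_graph G" and S: "S \<subseteq> pverts G" and forest: "is_forest (delete_verts G S)"
    and C: "path_cover (delete_verts G S) C" and w: "weighting G w"
    and k: "nullity_ge (pverts G) w k"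
  shows "k \<le> card C + card S"
proof (rule ccontr)
  assume "\<not> k \<le> card C + card S"
  have fin: "finite (pverts G)" by (rule pair_graphD(1)[OF G])
  have finC: "finite C" and finS: "finite S"
    using path_cover_finite[OF _ C] fin S finite_subset by auto
  have part: "partition_on (pverts G - S) C" using C by (simp add: path_cover_def)
  have "\<forall>W \<in> C. \<exists>xs. path_list (delete_verts G S) xs \<and> set xs = W"
    using C by (simp add: path_cover_def induces_path_iff)
  then obtain L where L: "\<And>W. W \<in> C \<Longrightarrow> path_list (delete_verts G S) (L W)"
    "\<And>W. W \<in> C \<Longrightarrow> set (L W) = W" by metis
  define Z where "Z = S \<union> (\<lambda>W. hd (L W)) ` C"
  define \<delta> where "\<delta> = (\<lambda>z v :: 'a. if v = z then 1 else 0 :: real)"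
  have "card Z \<le> card S + card C"
    unfolding Z_def using card_Un_le[of S] card_image_le[OF finC, of "\<lambda>W. hd (L W)"]
    by (meson add_le_mono le_trans order_refl)
  moreover have finZ: "finite Z" using finC finS by (simp add: Z_def)
  ultimately have "card (\<delta> ` Z) < k"
    using card_image_le[OF finZ, of \<delta>] \<open>\<not> k \<le> card C + card S\<close> by linarith
  then obtain x where x: "\<exists>v \<in> pverts G. x v \<noteq> 0" "\<And>u. u \<in> pverts G \<Longrightarrow> (\<Sum>v\<in>pverts G. w u v * x v) = 0"
    "\<And>\<phi>. \<phi> \<in> \<delta> ` Z \<Longrightarrow> (\<Sum>v\<in>pverts G. \<phi> v * x v) = 0"
    using nullity_geD[OF k, of "\<delta> ` Z"] finZ by blast
  have "Z \<subseteq> pverts G"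
  proof -
    have "hd (L W) \<in> pverts G" if "W \<in> C" for W
    proof -
      have "hd (L W) \<in> W" using L[OF that] by (metis hd_in_set path_list_def)
      then show ?thesis using part that by (auto simp: partition_on_def)
    qed
    then show ?thesis using S by (auto simp: Z_def)
  qed
  moreover have "(\<Sum>v\<in>pverts G. \<delta> z v * x v) = x z" if "z \<in> pverts G" for z
    using that fin by (simp add: \<delta>_def if_distrib[of "\<lambda>t. t * _"] cong: if_cong)
  ultimately have Z0: "x z = 0" if "z \<in> Z" for z
    using x(3)[of "\<delta> z"] that by auto
  have "\<forall>v \<in> pverts G. x v = 0"
    by (rule kernel_vector_forced_to_zero[OF G forest part L w x(2)]) (use Z0 in \<open>auto simp: Z_def\<close>)
  with x(1) show False by blast
qed

section \<open>Forests attain their path cover number\<close>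

text \<open>
  A kernel vector on \<open>G \<setminus> S\<close>, extended by \<open>0\<close>, fails to be a kernel vector on \<open>G\<close> only because of the rows
  indexed by \<open>S\<close>; these are \<open>card S\<close> further linear conditions.
\<close>

lemma nullity_extend_by_zero:
  assumes G: "pair_graph G" and S: "S \<subseteq> pverts G" and w': "weighting (delete_verts G S) w'"
    and k: "nullity_ge (pverts G - S) w' k"
  shows "\<exists>w. weighting G w \<and> nullity_ge (pverts G) w (k - card S)"
proof -
  define w where "w = (\<lambda>u v. if u \<in> S \<or> v \<in> S then (if (u, v) \<in> parcs G then 1 else 0) else w' u v)"
  have fin: "finite (pverts G)" "finite S" using pair_graphD(1)[OF G] S finite_subset by auto
  have "weighting G w"
    unfolding weighting_def
  proof (intro ballI)
    fix u v assume uv: "u \<in> pverts G" "v \<in> pverts G"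
    have "(u, v) \<in> parcs G \<longleftrightarrow> (v, u) \<in> parcs G" using pair_graphD(4)[OF G] by blast
    then show "w u v = w v u \<and> (u \<noteq> v \<longrightarrow> (w u v \<noteq> 0) = ((u, v) \<in> parcs G))"
      using w'[unfolded weighting_def, rule_format, of u v] uv by (auto simp: w_def)
  qed
  moreover have "nullity_ge (pverts G) w (k - card S)"
  proof (rule nullity_geI)
    fix \<Phi> :: "('a \<Rightarrow> real) set" assume fin\<Phi>: "finite \<Phi>" and card: "card \<Phi> < k - card S"
    have "card (\<Phi> \<union> w ` S) < k"
      using card_Un_le[of \<Phi> "w ` S"] card_image_le[OF fin(2), of w] card by linarith
    then obtain x where x: "\<exists>v \<in> pverts G - S. x v \<noteq> 0"
      "\<And>u. u \<in> pverts G - S \<Longrightarrow> (\<Sum>v\<in>pverts G - S. w' u v * x v) = 0"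
      "\<And>\<phi>. \<phi> \<in> \<Phi> \<union> w ` S \<Longrightarrow> (\<Sum>v\<in>pverts G - S. \<phi> v * x v) = 0"
      using nullity_geD[OF k, of "\<Phi> \<union> w ` S"] fin\<Phi> fin by blast
    define y where "y = (\<lambda>v. if v \<in> S then 0 else x v)"
    have y: "(\<Sum>v\<in>pverts G. \<phi> v * y v) = (\<Sum>v\<in>pverts G - S. \<phi> v * x v)" for \<phi>
      by (rule sum.mono_neutral_cong_right) (use fin in \<open>auto simp: y_def\<close>)
    have "(\<Sum>v\<in>pverts G. w u v * y v) = 0" if u: "u \<in> pverts G" for u
    proof (cases "u \<in> S")
      case True
      then show ?thesis using x(3)[of "w u"] y by simp
    next
      case False
      have "(\<Sum>v\<in>pverts G - S. w u v * x v) = (\<Sum>v\<in>pverts G - S. w' u v * x v)"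
        by (rule sum.cong) (use False in \<open>auto simp: w_def\<close>)
      then show ?thesis using x(2) u False y by simp
    qed
    moreover have "\<exists>v \<in> pverts G. y v \<noteq> 0" using x(1) by (auto simp: y_def)
    ultimately show "\<exists>x. (\<exists>v \<in> pverts G. x v \<noteq> 0) \<and>
      (\<forall>u \<in> pverts G. (\<Sum>v\<in>pverts G. w u v * x v) = 0) \<and> (\<forall>\<phi> \<in> \<Phi>. (\<Sum>v\<in>pverts G. \<phi> v * x v) = 0)"
      using x(3) y by (intro exI[of _ y]) auto
  qed
  ultimately show ?thesis by blast
qed

text \<open>
  The weight \<open>1\<close> on the leaf, on its edge, and added to the diagonal at \<open>y\<close> is chosen so that the Schur
  complement at the leaf is the old weighting: a kernel vector \<open>x\<close> extends by the value \<open>- x y\<close> at \<open>a\<close>.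
\<close>

lemma nullity_attach_leaf:
  assumes G: "pair_graph G" and ay: "(a, y) \<in> parcs G" and leaf: "\<And>z. (a, z) \<in> parcs G \<Longrightarrow> z = y"
    and w': "weighting (delete_verts G {a}) w'" and k: "nullity_ge (pverts G - {a}) w' k"
  shows "\<exists>w. weighting G w \<and> nullity_ge (pverts G) w k"
proof -
  define w where "w = (\<lambda>u v. if u = a then (if v = a \<or> v = y then 1 else 0)
    else if v = a then (if u = y then 1 else 0)
    else w' u v + (if u = y \<and> v = y then 1 else 0))"
  have fin: "finite (pverts G)" using pair_graphD(1)[OF G] .
  have ya: "y \<noteq> a" using ay pair_graphD(5)[OF G] by auto
  have aV: "a \<in> pverts G" and yV: "y \<in> pverts G - {a}"
    using pair_graphD(2,3)[OF G ay] ya by auto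
  have aiff: "(a, v) \<in> parcs G \<longleftrightarrow> v = y" "(v, a) \<in> parcs G \<longleftrightarrow> v = y" for v
    using ay leaf pair_graphD(4)[OF G] by blast+
  have "weighting G w"
    unfolding weighting_def
  proof (intro ballI)
    fix u v assume uv: "u \<in> pverts G" "v \<in> pverts G"
    show "w u v = w v u \<and> (u \<noteq> v \<longrightarrow> (w u v \<noteq> 0) = ((u, v) \<in> parcs G))"
    proof (cases "u = a \<or> v = a")
      case True
      then show ?thesis using aiff ya by (auto simp: w_def)
    next
      case False
      then show ?thesis using w'[unfolded weighting_def, rule_format, of u v] uv by (auto simp: w_def)
    qed
  qed
  moreover have "nullity_ge (pverts G) w k"
  proof (rule nullity_geI)
    fix \<Phi> :: "('a \<Rightarrow> real) set" assume fin\<Phi>: "finite \<Phi>" and card: "card \<Phi> < k"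
    define h where "h = (\<lambda>(\<phi> :: 'a \<Rightarrow> real) v. \<phi> v - (if v = y then \<phi> a else 0))"
    have "card (h ` \<Phi>) < k" using card card_image_le[OF fin\<Phi>, of h] by simp
    then obtain x where x: "\<exists>v \<in> pverts G - {a}. x v \<noteq> 0"
      "\<And>u. u \<in> pverts G - {a} \<Longrightarrow> (\<Sum>v\<in>pverts G - {a}. w' u v * x v) = 0"
      "\<And>\<phi>. \<phi> \<in> h ` \<Phi> \<Longrightarrow> (\<Sum>v\<in>pverts G - {a}. \<phi> v * x v) = 0"
      using nullity_geD[OF k, of "h ` \<Phi>"] fin\<Phi> by blast
    define z where "z = x(a := - x y)"
    have h: "(\<Sum>v\<in>pverts G. \<phi> v * z v) = (\<Sum>v\<in>pverts G - {a}. h \<phi> v * x v)" for \<phi>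
    proof -
      have "(\<Sum>v\<in>pverts G. \<phi> v * z v) = \<phi> a * z a + (\<Sum>v\<in>pverts G - {a}. \<phi> v * z v)"
        by (rule sum.remove[OF fin aV])
      also have "(\<Sum>v\<in>pverts G - {a}. \<phi> v * z v) = (\<Sum>v\<in>pverts G - {a}. \<phi> v * x v)"
        by (rule sum.cong) (auto simp: z_def)
      also have "(\<Sum>v\<in>pverts G - {a}. h \<phi> v * x v)
        = (\<Sum>v\<in>pverts G - {a}. \<phi> v * x v) - (\<Sum>v\<in>pverts G - {a}. if v = y then \<phi> a * x y else 0)"
        unfolding sum_subtractf[symmetric] by (rule sum.cong) (auto simp: h_def left_diff_distrib)
      ultimately show ?thesis using yV fin by (simp add: z_def)
    qed
    have "(\<Sum>v\<in>pverts G. w u v * z v) = 0" if u: "u \<in> pverts G" for u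
    proof (cases "u = a")
      case True
      have "(\<Sum>v\<in>pverts G - {a}. h (w u) v * x v) = 0"
        by (rule sum.neutral) (auto simp: h_def w_def True)
      then show ?thesis using h by simp
    next
      case False
      have "(\<Sum>v\<in>pverts G - {a}. h (w u) v * x v) = (\<Sum>v\<in>pverts G - {a}. w' u v * x v)"
        by (rule sum.cong) (use False ya in \<open>auto simp: h_def w_def\<close>)
      then show ?thesis using h x(2) u False by simp
    qed
    moreover have "\<exists>v \<in> pverts G. z v \<noteq> 0" using x(1) by (auto simp: z_def)
    ultimately show "\<exists>x. (\<exists>v \<in> pverts G. x v \<noteq> 0) \<and>
      (\<forall>u \<in> pverts G. (\<Sum>v\<in>pverts G. w u v * x v) = 0) \<and> (\<forall>\<phi> \<in> \<Phi>. (\<Sum>v\<in>pverts G. \<phi> v * x v) = 0)"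
      using x(3) h by (intro exI[of _ z]) auto
  qed
  ultimately show ?thesis by blast
qed

text \<open>
  Restoring \<open>v\<close> may fuse the paths in \<open>B\<close> into a single one.
\<close>

lemma path_cover_number_insert_vertex:
  assumes G: "pair_graph G" and v: "v \<in> pverts G" and C: "path_cover (delete_verts G {v}) C"
    and B: "B \<subseteq> C" and path: "induces_path G (insert v (\<Union>B))"
  shows "path_cover_number G \<le> Suc (card C - card B)"
proof -
  let ?C = "insert (insert v (\<Union>B)) (C - B)"
  have fin: "finite (pverts G)" by (rule pair_graphD(1)[OF G])
  have part: "partition_on (pverts G - {v}) C" using C by (simp add: path_cover_def)
  have U: "\<Union>C = pverts G - {v}" and ne: "{} \<notin> C"
    and disj: "\<And>W W'. W \<in> C \<Longrightarrow> W' \<in> C \<Longrightarrow> W \<noteq> W' \<Longrightarrow> W \<inter> W' = {}"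
    using part by (auto simp: partition_on_def disjoint_def)
  have finC: "finite C" using path_cover_finite[OF _ C] fin by simp
  have "path_cover G ?C"
    unfolding path_cover_def
  proof
    show "partition_on (pverts G) ?C"
      unfolding partition_on_def
    proof (intro conjI)
      have "\<Union>B \<union> \<Union>(C - B) = \<Union>C" using B by blast
      then show "\<Union>?C = pverts G" using U v by auto
      have new: "insert v (\<Union>B) \<inter> W = {}" if "W \<in> C - B" for W
        using U that disj[of _ W] B by blast
      show "disjoint ?C"
        unfolding disjoint_def using new disj by (auto simp: Int_commute) 
      show "{} \<notin> ?C" using ne by auto
    qed
    show "\<forall>W \<in> ?C. induces_path G W"
    proof
      fix W assume "W \<in> ?C"
      then consider "W = insert v (\<Union>B)" | "W \<in> C" by blast
      then show "induces_path G W"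
      proof cases
        case 2
        then have "v \<notin> W" using U by auto
        moreover obtain xs where "path_list (delete_verts G {v}) xs" "set xs = W"
          using C 2 by (auto simp: path_cover_def induces_path_iff)
        ultimately show ?thesis
          using path_list_delete_verts[of xs "{v}" G] unfolding induces_path_iff by auto
      qed (use path in simp)
    qed
  qed
  then have "path_cover_number G \<le> card ?C" by (rule path_cover_number_le[OF fin])
  also have "\<dots> \<le> Suc (card (C - B))" by (simp add: card_insert_if finC)
  also have "card (C - B) = card C - card B"
    using B finC by (meson card_Diff_subset finite_subset)
  finally show ?thesis .
qed

text \<open>
  In \<open>G \<setminus> {a}\<close> the vertex \<open>y\<close> has degree at most one, so it is an end of its path, which can be prolonged by
  \<open>a\<close>.
\<close>

lemma path_cover_number_leaf:
  assumes G: "pair_graph G" and ay: "(a, y) \<in> parcs G" and leaf: "\<And>z. (a, z) \<in> parcs G \<Longrightarrow> z = y"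
    and deg: "\<And>b c. (y, b) \<in> parcs G \<Longrightarrow> (y, c) \<in> parcs G \<Longrightarrow> b \<noteq> a \<Longrightarrow> c \<noteq> a \<Longrightarrow> b = c"
  shows "path_cover_number G \<le> path_cover_number (delete_verts G {a})"
proof -
  have H: "pair_graph (delete_verts G {a})" by (rule pair_graph_delete_verts[OF G])
  obtain C where C: "path_cover (delete_verts G {a}) C" "card C = path_cover_number (delete_verts G {a})"
    using path_cover_number_attained[OF H] by blast
  have ya: "y \<noteq> a" using ay pair_graphD(5)[OF G] by auto
  have aV: "a \<in> pverts G" and yV: "y \<in> pverts G - {a}"
    using pair_graphD(2,3)[OF G ay] ya by auto
  have U: "\<Union>C = pverts G - {a}" using C(1) by (simp add: path_cover_def partition_on_def)
  then obtain W where W: "W \<in> C" "y \<in> W" using yV by blast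
  then obtain xs where xs: "path_list (delete_verts G {a}) xs" "set xs = W"
    using C(1) by (auto simp: path_cover_def induces_path_iff)
  have aW: "a \<notin> W" using U W by auto
  obtain i where i: "i < length xs" "xs ! i = y" using xs W by (metis in_set_conv_nth)
  have "i = 0 \<or> Suc i = length xs"
  proof (rule ccontr)
    assume n: "\<not> (i = 0 \<or> Suc i = length xs)"
    then have "(y, xs ! (i - 1)) \<in> parcs (delete_verts G {a})" "(y, xs ! Suc i) \<in> parcs (delete_verts G {a})"
      using i path_list_arc_iff[OF xs(1), of i "i - 1"] path_list_arc_iff[OF xs(1), of i "Suc i"] by auto
    then have "xs ! (i - 1) = xs ! Suc i" using deg by auto
    then show False using xs(1) n i by (auto simp: path_list_def nth_eq_iff_index_eq)
  qed
  then have "\<exists>ys. path_list (delete_verts G {a}) ys \<and> set ys = W \<and> ys ! 0 = y"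
  proof
    assume "Suc i = length xs"
    moreover have "rev xs ! 0 = xs ! (length xs - Suc 0)" using i by (intro rev_nth) auto
    ultimately have "rev xs ! 0 = y" using i by (metis diff_Suc_1 One_nat_def)
    then show ?thesis using path_list_rev[OF xs(1)] xs(2) by (intro exI[of _ "rev xs"]) auto
  qed (use xs i in blast)
  then obtain ys where ys: "path_list (delete_verts G {a}) ys" "set ys = W" "ys ! 0 = y" by blast
  then have ys': "path_list G ys" using path_list_delete_verts[of ys "{a}" G] aW by auto
  have aiff: "(a, v) \<in> parcs G \<longleftrightarrow> v = y" "(v, a) \<in> parcs G \<longleftrightarrow> v = y" for v
    using ay leaf pair_graphD(4)[OF G] by blast+
  have y0: "ys ! j = y \<longleftrightarrow> j = 0" if "j < length ys" for j
    using ys' ys(3) that unfolding path_list_def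
    by (metis gr_zeroI not_less_zero nth_eq_iff_index_eq order.strict_trans)
  have "path_list G (a # ys)"
    unfolding path_list_def
  proof (intro conjI allI impI)
    show "distinct (a # ys)" using ys' ys(2) aW by (simp add: path_list_def)
    fix i j assume ij: "i < length (a # ys)" "j < length (a # ys)"
    show "((a # ys) ! i, (a # ys) ! j) \<in> parcs G \<longleftrightarrow> j = Suc i \<or> i = Suc j"
      using ij aiff ya y0 path_list_arc_iff[OF ys', of "i - 1" "j - 1"]
      by (cases i; cases j) auto
  qed simp
  then have "induces_path G (insert a (\<Union>{W}))"
    unfolding induces_path_iff using ys(2) by (intro exI[of _ "a # ys"]) auto
  from path_cover_number_insert_vertex[OF G aV C(1) _ this]
  have "path_cover_number G \<le> Suc (card C - 1)" using W by simp
  moreover have "card C > 0" using W path_cover_finite[OF _ C(1)] pair_graphD(1)[OF G] card_gt_0_iff by force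
  ultimately show ?thesis using C(2) by simp
qed

lemma isolated_vertex_is_cell:
  assumes C: "path_cover G C" and W: "W \<in> C" "a \<in> W" and iso: "\<And>z. (a, z) \<notin> parcs G"
  shows "W = {a}"
proof -
  obtain xs where xs: "path_list G xs" "set xs = W"
    using C W by (auto simp: path_cover_def induces_path_iff)
  obtain i where i: "i < length xs" "xs ! i = a" using xs W by (metis in_set_conv_nth)
  have "length xs = 1"
  proof (rule ccontr)
    assume "length xs \<noteq> 1"
    with i have "2 \<le> length xs" by linarith
    then have "(if i = 0 then 1 else i - 1) < length xs" using i by auto
    then have "\<exists>j<length xs. j = Suc i \<or> i = Suc j"
      by (intro exI[of _ "if i = 0 then 1 else i - 1"]) auto
    then show False using path_list_arc_iff[OF xs(1) i(1)] i iso by auto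
  qed
  then show ?thesis using xs i by (auto simp: length_Suc_conv)
qed

text \<open>
  Without \<open>y\<close>, the leaves \<open>a\<close> and \<open>b\<close> are isolated and occupy two paths of any cover; these can be replaced
  by the single path \<open>a, y, b\<close>.
\<close>

lemma path_cover_number_cherry:
  assumes G: "pair_graph G" and ab: "a \<noteq> b" and ay: "(a, y) \<in> parcs G" and bY: "(b, y) \<in> parcs G"
    and la: "\<And>z. (a, z) \<in> parcs G \<Longrightarrow> z = y" and lb: "\<And>z. (b, z) \<in> parcs G \<Longrightarrow> z = y"
  shows "path_cover_number G + 1 \<le> path_cover_number (delete_verts G {y})"
proof -
  have H: "pair_graph (delete_verts G {y})" by (rule pair_graph_delete_verts[OF G])
  obtain C where C: "path_cover (delete_verts G {y}) C" "card C = path_cover_number (delete_verts G {y})"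
    using path_cover_number_attained[OF H] by blast
  have ne: "a \<noteq> y" "b \<noteq> y" using ay bY pair_graphD(5)[OF G] by auto
  have inV: "a \<in> pverts G" "b \<in> pverts G" "y \<in> pverts G"
    using pair_graphD(2,3)[OF G] ay bY by blast+
  have U: "\<Union>C = pverts G - {y}" using C(1) by (simp add: path_cover_def partition_on_def)
  have cell: "{c} \<in> C" if "c = a \<or> c = b" for c
  proof -
    have "c \<in> \<Union>C" using U inV ne that by auto
    then obtain W where "W \<in> C" "c \<in> W" by blast
    moreover have "(c, z) \<notin> parcs (delete_verts G {y})" for z using that la lb by auto
    ultimately show ?thesis using isolated_vertex_is_cell[OF C(1)] by metis
  qed
  have nab: "(a, b) \<notin> parcs G" "(b, a) \<notin> parcs G" using la lb ne by blast+
  have "path_list G [a, y, b]"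
    unfolding path_list_def
    using ne ab ay bY nab pair_graphD(4)[OF G ay] pair_graphD(4)[OF G bY] pair_graphD(5)[OF G]
    by (auto simp: less_Suc_eq nth_Cons')
  then have "induces_path G (insert y (\<Union>{{a}, {b}}))"
    unfolding induces_path_iff by (intro exI[of _ "[a, y, b]"]) auto
  from path_cover_number_insert_vertex[OF G inV(3) C(1) _ this]
  have "path_cover_number G \<le> Suc (card C - 2)" using cell ab by simp
  moreover have "card {{a}, {b}} \<le> card C"
    by (rule card_mono) (use path_cover_finite[OF _ C(1)] pair_graphD(1)[OF G] cell in auto)
  ultimately show ?thesis using C(2) ab by simp
qed

lemma forest_nullity_path_cover_number:
  assumes "pair_graph F" "is_forest F"
  shows "\<exists>w. weighting F w \<and> nullity_ge (pverts F) w (path_cover_number F)"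
  using assms
proof (induction "card (pverts F)" arbitrary: F rule: less_induct)
  case less
  note F = less.prems(1) and forest = less.prems(2)
  have fin: "finite (pverts F)" by (rule pair_graphD(1)[OF F])
  have IH: "\<exists>w. weighting (delete_verts F {v}) w \<and>
      nullity_ge (pverts F - {v}) w (path_cover_number (delete_verts F {v}))" if "v \<in> pverts F" for v
  proof -
    have "card (pverts (delete_verts F {v})) < card (pverts F)"
      using that fin card_Diff1_less[of "pverts F" v] by simp
    from less.hyps[OF this pair_graph_delete_verts[OF F] is_forest_delete_verts[OF F forest]]
    show ?thesis by simp
  qed
  show ?case
  proof (cases "parcs F = {}")
    case True
    obtain C where C: "path_cover F C" "card C = path_cover_number F"
      using path_cover_number_attained[OF F] by blast
    have sub: "C \<subseteq> (\<lambda>v. {v}) ` pverts F"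
    proof
      fix W assume W: "W \<in> C"
      then have "W \<noteq> {}" "W \<subseteq> pverts F" using C(1) by (auto simp: path_cover_def partition_on_def)
      then obtain a where "a \<in> W" "a \<in> pverts F" by blast
      then show "W \<in> (\<lambda>v. {v}) ` pverts F" using isolated_vertex_is_cell[OF C(1) W] True by auto
    qed
    have le: "path_cover_number F \<le> card (pverts F)"
      using card_mono[OF _ sub] fin card_image_le[OF fin, of "\<lambda>v. {v}"] C(2) by simp
    have "weighting F (\<lambda>_ _. 0)" using True by (simp add: weighting_def)
    moreover have "nullity_ge (pverts F) (\<lambda>_ _. 0) (path_cover_number F)"
    proof (rule nullity_geI)
      fix \<Phi> :: "('a \<Rightarrow> real) set" assume "finite \<Phi>" "card \<Phi> < path_cover_number F"
      then show "\<exists>x. (\<exists>v\<in>pverts F. x v \<noteq> 0) \<and> (\<forall>u\<in>pverts F. (\<Sum>v\<in>pverts F. 0 * x v) = 0) \<and>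
          (\<forall>\<phi>\<in>\<Phi>. (\<Sum>v\<in>pverts F. \<phi> v * x v) = 0)"
        using underdetermined_system[of \<Phi> "pverts F"] fin le by auto
    qed
    ultimately show ?thesis by blast
  next
    case False
    show ?thesis
    proof (rule forest_peel[OF F forest False])
      fix a y
      assume leaf: "(a, y) \<in> parcs F" "\<And>z. (a, z) \<in> parcs F \<Longrightarrow> z = y"
        "\<And>b c. (y, b) \<in> parcs F \<Longrightarrow> (y, c) \<in> parcs F \<Longrightarrow> b \<noteq> a \<Longrightarrow> c \<noteq> a \<Longrightarrow> b = c"
      have "a \<in> pverts F" using pair_graphD(2)[OF F leaf(1)] .
      from IH[OF this] obtain w' where w': "weighting (delete_verts F {a}) w'"
        "nullity_ge (pverts F - {a}) w' (path_cover_number (delete_verts F {a}))" by blast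
      have "path_cover_number F \<le> path_cover_number (delete_verts F {a})"
        by (rule path_cover_number_leaf[OF F leaf])
      with w'(2) have "nullity_ge (pverts F - {a}) w' (path_cover_number F)"
        unfolding nullity_ge_def by auto
      from nullity_attach_leaf[OF F leaf(1,2) w'(1) this] show ?thesis .
    next
      fix a b y
      assume cherry: "a \<noteq> b" "(a, y) \<in> parcs F" "(b, y) \<in> parcs F"
        "\<And>z. (a, z) \<in> parcs F \<Longrightarrow> z = y" "\<And>z. (b, z) \<in> parcs F \<Longrightarrow> z = y"
      have y: "y \<in> pverts F" using pair_graphD(3)[OF F cherry(2)] .
      from IH[OF this] obtain w' where w': "weighting (delete_verts F {y}) w'"
        "nullity_ge (pverts F - {y}) w' (path_cover_number (delete_verts F {y}))" by blast
      from nullity_extend_by_zero[OF F _ w'] y obtain w where w: "weighting F w"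
        "nullity_ge (pverts F) w (path_cover_number (delete_verts F {y}) - 1)" by auto
      have "path_cover_number F \<le> path_cover_number (delete_verts F {y}) - 1"
        using path_cover_number_cherry[OF F cherry] by simp
      with w(2) have "nullity_ge (pverts F) w (path_cover_number F)"
        unfolding nullity_ge_def by auto
      with w(1) show ?thesis by blast
    qed
  qed
qed

section \<open>The two bounds\<close>

lemma finite_deletion_sets:
  "finite (pverts G) \<Longrightarrow> finite {f S | S. S \<subseteq> pverts G \<and> is_forest (delete_verts G S)}"
  by (rule finite_subset[of _ "f ` Pow (pverts G)"]) auto

lemma is_forest_delete_all:
  assumes G: "pair_graph G"
  shows "is_forest (delete_verts G (pverts G))"
  by (rule is_forestI_rank[OF pair_graph_delete_verts[OF G], where r = "\<lambda>_. 0"])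
    (use pair_graphD(2)[OF G] in auto)

lemma T_minus_le_max_multiplicity:
  assumes G: "pair_graph G"
  shows "T_minus G \<le> int (max_multiplicity G)"
proof -
  let ?X = "{int (path_cover_number (delete_verts G S)) - int (card S) | S.
     S \<subseteq> pverts G \<and> is_forest (delete_verts G S)}"
  have fin: "finite ?X" by (rule finite_deletion_sets[OF pair_graphD(1)[OF G]])
  have "?X \<noteq> {}" using is_forest_delete_all[OF G] by blast
  from Max_in[OF fin this] obtain S where S: "S \<subseteq> pverts G" "is_forest (delete_verts G S)"
    and T: "T_minus G = int (path_cover_number (delete_verts G S)) - int (card S)"
    unfolding T_minus_def by auto
  obtain w' where "weighting (delete_verts G S) w'"
    "nullity_ge (pverts G - S) w' (path_cover_number (delete_verts G S))"
    using forest_nullity_path_cover_number[OF pair_graph_delete_verts[OF G] S(2)] by auto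
  from nullity_extend_by_zero[OF G S(1) this]
  have "path_cover_number (delete_verts G S) - card S \<le> max_multiplicity G"
    using le_max_multiplicity_iff[OF pair_graphD(1)[OF G] pair_graphD(4)[OF G]] by blast
  then show ?thesis unfolding T by linarith
qed

lemma max_multiplicity_le_T_plus:
  assumes G: "pair_graph G"
  shows "int (max_multiplicity G) \<le> T_plus G"
proof -
  let ?X = "{int (path_cover_number (delete_verts G S)) + int (card S) | S.
     S \<subseteq> pverts G \<and> is_forest (delete_verts G S)}"
  have fin: "finite ?X" by (rule finite_deletion_sets[OF pair_graphD(1)[OF G]])
  have "?X \<noteq> {}" using is_forest_delete_all[OF G] by blast
  from Min_in[OF fin this] obtain S where S: "S \<subseteq> pverts G" "is_forest (delete_verts G S)"
    and T: "T_plus G = int (path_cover_number (delete_verts G S)) + int (card S)"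
    unfolding T_plus_def by auto
  obtain C where C: "path_cover (delete_verts G S) C" "card C = path_cover_number (delete_verts G S)"
    using path_cover_number_attained[OF pair_graph_delete_verts[OF G]] by blast
  obtain w where "weighting G w" "nullity_ge (pverts G) w (max_multiplicity G)"
    using le_max_multiplicity_iff[OF pair_graphD(1)[OF G] pair_graphD(4)[OF G], of "max_multiplicity G"]
    by blast
  from nullity_le_path_cover[OF G S C(1) this] show ?thesis unfolding T C(2) by linarith
qed



section \<open>The 5-sun\<close>

lemma less_five: "i < (5::nat) \<longleftrightarrow> i = 0 \<or> i = 1 \<or> i = 2 \<or> i = 3 \<or> i = 4"
  by auto

lemma pair_graph_sun: "3 \<le> n \<Longrightarrow> pair_graph (sun n)"
  unfolding pair_graph_iff sun_def cycle_arcs_def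
  by (auto simp: mod_Suc split: if_splits)

lemma sun5_arc_iff:
  assumes "i < 5"
  shows "(i, v) \<in> parcs (sun 5) \<longleftrightarrow> v = Suc i mod 5 \<or> v = (i + 4) mod 5 \<or> v = 5 + i"
    and "(5 + i, v) \<in> parcs (sun 5) \<longleftrightarrow> v = i"
proof -
  have "v < 5 \<and> i = Suc v mod 5 \<longleftrightarrow> v = (i + 4) mod 5"
  proof (cases "v < 5")
    case True
    then show ?thesis
      using assms unfolding less_five by (elim disjE; hypsubst; simp)
  qed auto
  then show "(i, v) \<in> parcs (sun 5) \<longleftrightarrow> v = Suc i mod 5 \<or> v = (i + 4) mod 5 \<or> v = 5 + i"
    using assms by (auto simp: sun_def cycle_arcs_def)
qed (use assms in \<open>auto simp: sun_def cycle_arcs_def\<close>)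

lemma sum_weights_row:
  assumes G: "pair_graph G" and w: "weighting G w" and u: "u \<in> pverts G"
    and N: "{v. (u, v) \<in> parcs G} = N"
  shows "(\<Sum>v\<in>pverts G. w u v * x v) = w u u * x u + (\<Sum>v\<in>N. w u v * x v)"
proof -
  have fin: "finite (pverts G)" by (rule pair_graphD(1)[OF G])
  have NV: "N \<subseteq> pverts G - {u}"
    using N pair_graphD(3,5)[OF G] by blast
  have "(\<Sum>v\<in>pverts G. w u v * x v) = w u u * x u + (\<Sum>v\<in>pverts G - {u}. w u v * x v)"
    by (rule sum.remove[OF fin u])
  also have "(\<Sum>v\<in>pverts G - {u}. w u v * x v) = (\<Sum>v\<in>N. w u v * x v)"
  proof (rule sum.mono_neutral_right)
    show "\<forall>v \<in> pverts G - {u} - N. w u v * x v = 0"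
    proof
      fix v assume "v \<in> pverts G - {u} - N"
      then have "w u v = 0" using N w[unfolded weighting_def, rule_format, OF u, of v] by blast
      then show "w u v * x v = 0" by simp
    qed
  qed (use fin NV in auto)
  finally show ?thesis .
qed

text \<open>
  The zero pattern \<open>z\<close> of a kernel vector of a weighting of the \<open>5\<close>-sun along the cycle \<open>a, b, c, d, e\<close>, where
  \<open>k\<close> marks the cycle vertices whose pendant neighbour has diagonal entry \<open>0\<close>. The pendant row forces
  a zero at a marked vertex. At an unmarked vertex carrying a zero, the pendant entry is zero too, so the
  row of that vertex relates just its two neighbours on the cycle.
\<close>

definition cycle5_closed :: "('a \<Rightarrow> bool) \<Rightarrow> ('a \<Rightarrow> bool) \<Rightarrow> 'a \<Rightarrow> 'a \<Rightarrow> 'a \<Rightarrow> 'a \<Rightarrow> 'a \<Rightarrow> bool" where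
  "cycle5_closed k z a b c d e \<longleftrightarrow>
     (k a \<longrightarrow> z a) \<and> (k b \<longrightarrow> z b) \<and> (k c \<longrightarrow> z c) \<and> (k d \<longrightarrow> z d) \<and> (k e \<longrightarrow> z e) \<and>
     (\<not> k a \<and> z a \<longrightarrow> (z e \<longleftrightarrow> z b)) \<and> (\<not> k b \<and> z b \<longrightarrow> (z a \<longleftrightarrow> z c)) \<and>
     (\<not> k c \<and> z c \<longrightarrow> (z b \<longleftrightarrow> z d)) \<and> (\<not> k d \<and> z d \<longrightarrow> (z c \<longleftrightarrow> z e)) \<and>
     (\<not> k e \<and> z e \<longrightarrow> (z d \<longleftrightarrow> z a))"

lemma cycle5_closed_rotate: "cycle5_closed k z a b c d e \<Longrightarrow> cycle5_closed k z b c d e a"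
  unfolding cycle5_closed_def by blast

lemma cycle5_forced_by_two_at:
  assumes "k a"
  shows "\<exists>u v. {u, v} \<subseteq> {a, b, c, d, e} \<and>
    (\<forall>z. z u \<and> z v \<and> cycle5_closed k z a b c d e \<longrightarrow> z a \<and> z b \<and> z c \<and> z d \<and> z e)"
proof -
  consider "\<not> k b" "k d" | "\<not> k b" "\<not> k d" | "k b" "k c" | "k b" "\<not> k c" by blast
  then show ?thesis
  proof cases
    case 1
    show ?thesis by (rule exI[of _ b], rule exI[of _ e]) (use assms 1 in \<open>auto simp: cycle5_closed_def\<close>)
  next
    case 2
    show ?thesis by (rule exI[of _ b], rule exI[of _ d]) (use assms 2 in \<open>auto simp: cycle5_closed_def\<close>)
  next
    case 3
    show ?thesis by (rule exI[of _ d], rule exI[of _ e]) (use assms 3 in \<open>auto simp: cycle5_closed_def\<close>)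
  next
    case 4
    show ?thesis by (rule exI[of _ c], rule exI[of _ e]) (use assms 4 in \<open>auto simp: cycle5_closed_def\<close>)
  qed
qed

text \<open>
  Without marked vertices two adjacent zeros spread around the cycle; otherwise rotate a marked vertex to
  the first place.
\<close>

lemma cycle5_forced_by_two:
  "\<exists>u v. {u, v} \<subseteq> {a, b, c, d, e} \<and>
    (\<forall>z. z u \<and> z v \<and> cycle5_closed k z a b c d e \<longrightarrow> z a \<and> z b \<and> z c \<and> z d \<and> z e)"
proof -
  define D where "D = (\<lambda>a b c d e. \<exists>u v. {u, v} \<subseteq> {a, b, c, d, e} \<and>
    (\<forall>z. z u \<and> z v \<and> cycle5_closed k z a b c d e \<longrightarrow> z a \<and> z b \<and> z c \<and> z d \<and> z e))"
  have aux: "D a b c d e" if "k a" for a b c d e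
    unfolding D_def by (rule cycle5_forced_by_two_at[of k, OF that])
  have rot: "D a b c d e" if D: "D b c d e a" for a b c d e
  proof -
    from D obtain u v where uv: "{u, v} \<subseteq> {b, c, d, e, a}"
      and z: "\<And>z. z u \<and> z v \<and> cycle5_closed k z b c d e a \<Longrightarrow> z b \<and> z c \<and> z d \<and> z e \<and> z a"
      unfolding D_def by auto
    have "z a \<and> z b \<and> z c \<and> z d \<and> z e" if "z u \<and> z v \<and> cycle5_closed k z a b c d e" for z
      using z[of z] cycle5_closed_rotate[of k z a b c d e] that by simp
    with uv show ?thesis
      unfolding D_def by - (rule exI[of _ u], rule exI[of _ v], auto)
  qed
  consider "k a" | "k b" | "k c" | "k d" | "k e" | "\<not> k a" "\<not> k b" "\<not> k c" "\<not> k d" "\<not> k e" by blast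
  then have "D a b c d e"
  proof cases
    case 6
    show ?thesis
      unfolding D_def
      by (rule exI[of _ a], rule exI[of _ b]) (use 6 in \<open>auto simp: cycle5_closed_def\<close>)
  next
    case 1
    then show ?thesis by (rule aux)
  next
    case 2
    show ?thesis by (rule rot, rule aux, rule 2)
  next
    case 3
    show ?thesis by (rule rot, rule rot, rule aux, rule 3)
  next
    case 4
    show ?thesis by (rule rot, rule rot, rule rot, rule aux, rule 4)
  next
    case 5
    show ?thesis by (rule rot, rule rot, rule rot, rule rot, rule aux, rule 5)
  qed
  then show ?thesis unfolding D_def .
qed

lemma max_multiplicity_sun5_le: "max_multiplicity (sun 5) \<le> 2"
proof (rule ccontr)
  assume "\<not> max_multiplicity (sun 5) \<le> 2"
  then have "3 \<le> max_multiplicity (sun 5)" by simp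
  have G: "pair_graph (sun 5)" by (rule pair_graph_sun) simp
  obtain w where w: "weighting (sun 5) w" and nul: "nullity_ge (pverts (sun 5)) w 3"
    using \<open>3 \<le> max_multiplicity (sun 5)\<close>
      le_max_multiplicity_iff[OF pair_graphD(1)[OF G] pair_graphD(4)[OF G]] by blast
  have V: "pverts (sun 5) = {..<10}" by (simp add: sun_def)
  define k where "k = (\<lambda>i. w (5 + i) (5 + i) = 0)"
  from cycle5_forced_by_two[of 0 1 2 3 4 k] obtain a b where ab: "{a, b} \<subseteq> {0, 1, 2, 3, 4 :: nat}"
    and force: "\<forall>z. z a \<and> z b \<and> cycle5_closed k z 0 1 2 3 4 \<longrightarrow> z 0 \<and> z 1 \<and> z 2 \<and> z 3 \<and> z 4"
    by (elim exE conjE)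
  define \<delta> where "\<delta> = (\<lambda>(z::nat) v. if v = z then 1 else 0 :: real)"
  have "card {\<delta> a, \<delta> b} < 3" by (simp add: card_insert_if)
  then obtain x where "\<exists>v \<in> pverts (sun 5). x v \<noteq> 0"
    "\<And>u. u \<in> pverts (sun 5) \<Longrightarrow> (\<Sum>v\<in>pverts (sun 5). w u v * x v) = 0"
    "\<And>\<phi>. \<phi> \<in> {\<delta> a, \<delta> b} \<Longrightarrow> (\<Sum>v\<in>pverts (sun 5). \<phi> v * x v) = 0"
    using nullity_geD[OF nul, of "{\<delta> a, \<delta> b}"] by blast
  note x = this[unfolded V lessThan_iff]
  have "(\<Sum>v<10. \<delta> c v * x v) = x c" if "c < 10" for c
    using that by (simp add: \<delta>_def if_distrib[of "\<lambda>t. t * _"] cong: if_cong)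
  then have xab: "x a = 0" "x b = 0" using x(3)[of "\<delta> a"] x(3)[of "\<delta> b"] ab by auto
  have cyc: "w i i * x i + (w i (Suc i mod 5) * x (Suc i mod 5) +
      (w i ((i + 4) mod 5) * x ((i + 4) mod 5) + w i (5 + i) * x (5 + i))) = 0" if i: "i < 5" for i
  proof -
    have "{v. (i, v) \<in> parcs (sun 5)} = {Suc i mod 5, (i + 4) mod 5, 5 + i}"
      using sun5_arc_iff(1)[OF i] by auto
    moreover have "Suc i mod 5 \<noteq> (i + 4) mod 5" "Suc i mod 5 \<noteq> 5 + i" "(i + 4) mod 5 \<noteq> 5 + i"
      using i by (auto simp: less_five)
    ultimately show ?thesis
      using sum_weights_row[OF G w, of i _ x] x(2)[of i] i unfolding V by simp
  qed
  have pen: "w (5 + i) (5 + i) * x (5 + i) + w (5 + i) i * x i = 0" if i: "i < 5" for i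
  proof -
    have "{v. (5 + i, v) \<in> parcs (sun 5)} = {i}"
      using sun5_arc_iff(2)[OF i] by auto
    then show ?thesis
      using sum_weights_row[OF G w, of "5 + i" _ x] x(2)[of "5 + i"] i unfolding V by simp
  qed
  have nz: "w u v \<noteq> 0" if "(u, v) \<in> parcs (sun 5)" for u v
    using w[unfolded weighting_def, rule_format, of u v] that pair_graphD(2,3)[OF G that] pair_graphD(5)[OF G]
    by auto
  have nzi: "w i (Suc i mod 5) \<noteq> 0" "w i ((i + 4) mod 5) \<noteq> 0" "w i (5 + i) \<noteq> 0" "w (5 + i) i \<noteq> 0"
    if "i < 5" for i
    using nz sun5_arc_iff[OF that] by blast+
  \<comment> \<open>The next three facts are the closure rules of \<open>cycle5_closed\<close> for the zero pattern of \<open>x\<close>.\<close>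
  have zero_at_k: "x i = 0" if "i < 5" "k i" for i
    using pen[OF that(1)] nzi(4)[OF that(1)] that(2) by (simp add: k_def)
  have zero_pendant: "x (5 + i) = 0" if "i < 5" "\<not> k i" "x i = 0" for i
    using pen[OF that(1)] that(2,3) by (simp add: k_def)
  have step: "x ((i + 4) mod 5) = 0 \<longleftrightarrow> x (Suc i mod 5) = 0" if "i < 5" "\<not> k i" "x i = 0" for i
    using cyc[OF that(1)] nzi[OF that(1)] zero_pendant[OF that] that(3) by auto
  have lt: "0 < (5::nat)" "1 < (5::nat)" "2 < (5::nat)" "3 < (5::nat)" "4 < (5::nat)" by simp_all
  have step': "x h = 0 \<longleftrightarrow> x j = 0"
    if "i < 5" "j = Suc i mod 5" "h = (i + 4) mod 5" "\<not> k i" "x i = 0" for h i j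
    unfolding that(2,3) by (rule step[OF that(1,4,5)])
  have s: "\<not> k 0 \<Longrightarrow> x 0 = 0 \<Longrightarrow> x 4 = 0 \<longleftrightarrow> x 1 = 0"
    "\<not> k 1 \<Longrightarrow> x 1 = 0 \<Longrightarrow> x 0 = 0 \<longleftrightarrow> x 2 = 0"
    "\<not> k 2 \<Longrightarrow> x 2 = 0 \<Longrightarrow> x 1 = 0 \<longleftrightarrow> x 3 = 0"
    "\<not> k 3 \<Longrightarrow> x 3 = 0 \<Longrightarrow> x 2 = 0 \<longleftrightarrow> x 4 = 0"
    "\<not> k 4 \<Longrightarrow> x 4 = 0 \<Longrightarrow> x 3 = 0 \<longleftrightarrow> x 0 = 0"
    by (rule step'[of 0] step'[of 1] step'[of 2] step'[of 3] step'[of 4]; simp)+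
  have "cycle5_closed k (\<lambda>i. x i = 0) 0 1 2 3 4"
    unfolding cycle5_closed_def
    using zero_at_k[OF lt(1)] zero_at_k[OF lt(2)] zero_at_k[OF lt(3)] zero_at_k[OF lt(4)]
      zero_at_k[OF lt(5)] s by blast
  with force xab have "x 0 = 0 \<and> x 1 = 0 \<and> x 2 = 0 \<and> x 3 = 0 \<and> x 4 = 0"
    by (intro force[rule_format, of "\<lambda>i. x i = 0"]) simp
  then have z: "x i = 0" if "i < 5" for i
    using that by (auto simp: less_five)
  have "x (5 + i) = 0" if "i < 5" for i
    using cyc[OF that] nzi(3)[OF that] z[OF that] z[of "Suc i mod 5"] z[of "(i + 4) mod 5"] by simp
  then have "x v = 0" if "v < 10" for v
    using z[of v] \<open>\<And>i. i < 5 \<Longrightarrow> x (5 + i) = 0\<close>[of "v - 5"] that by (cases "v < 5") auto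
  with x(1) show False by auto
qed

text \<open>
  A vertex of degree at most one can only be an end of its path.
\<close>

lemma card_leaves_le_path_cover:
  assumes C: "path_cover G C" and fin: "finite (pverts G)" and L: "L \<subseteq> pverts G"
    and leaf: "\<And>v a b. v \<in> L \<Longrightarrow> (v, a) \<in> parcs G \<Longrightarrow> (v, b) \<in> parcs G \<Longrightarrow> a = b"
  shows "card L \<le> 2 * card C"
proof -
  have finC: "finite C" by (rule path_cover_finite[OF fin C])
  have two: "card (W \<inter> L) \<le> 2" if W: "W \<in> C" for W
  proof -
    obtain xs where xs: "path_list G xs" "set xs = W"
      using C W by (auto simp: path_cover_def induces_path_iff)
    have "W \<inter> L \<subseteq> {xs ! 0, xs ! (length xs - 1)}"
    proof
      fix v assume v: "v \<in> W \<inter> L"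
      then obtain i where i: "i < length xs" "xs ! i = v" using xs by (auto simp: in_set_conv_nth)
      have "i = 0 \<or> Suc i = length xs"
      proof (rule ccontr)
        assume n: "\<not> (i = 0 \<or> Suc i = length xs)"
        then have "(v, xs ! (i - 1)) \<in> parcs G" "(v, xs ! Suc i) \<in> parcs G"
          using i path_list_arc_iff[OF xs(1), of i "i - 1"] path_list_arc_iff[OF xs(1), of i "Suc i"] by auto
        then have "xs ! (i - 1) = xs ! Suc i" using leaf v by auto
        then show False using xs(1) n i by (auto simp: path_list_def nth_eq_iff_index_eq)
      qed
      then have "i = 0 \<or> i = length xs - 1" by auto
      then show "v \<in> {xs ! 0, xs ! (length xs - 1)}" using i by auto
    qed
    then have "card (W \<inter> L) \<le> card {xs ! 0, xs ! (length xs - 1)}" by (intro card_mono) auto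
    also have "\<dots> \<le> 2" by (simp add: card_insert_if)
    finally show ?thesis .
  qed
  have "L = (\<Union>W\<in>C. W \<inter> L)" using C L by (auto simp: path_cover_def partition_on_def)
  then have "card L \<le> (\<Sum>W\<in>C. card (W \<inter> L))" using card_UN_le[OF finC, of "\<lambda>W. W \<inter> L"] by simp
  also have "\<dots> \<le> (\<Sum>W\<in>C. 2)" by (intro sum_mono two)
  finally show ?thesis by (simp add: mult.commute)
qed

lemma T_minus_sun5_ge: "2 \<le> T_minus (sun 5)"
proof -
  have G: "pair_graph (sun 5)" by (rule pair_graph_sun) simp
  define F where "F = delete_verts (sun 5) {0}"
  have F: "pair_graph F" unfolding F_def by (rule pair_graph_delete_verts[OF G])
  have inV: "u < 10" if "(u, v) \<in> parcs (sun 5)" for u v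
    using pair_graphD(2)[OF G that] by (simp add: sun_def)
  have pendant: "v = u - 5" if "(u, v) \<in> parcs F" "5 \<le> u" for u v
    using that inV[of u v] sun5_arc_iff(2)[of "u - 5" v] by (auto simp: F_def)
  have forest: "is_forest F"
  \<comment> \<open>Pendant vertices come first, then the remaining cycle vertices in the order \<open>1, 2, 3, 4\<close>.\<close>
  proof (rule is_forestI_rank[OF F, where r = "\<lambda>v. if v < 5 then v else 0"])
    fix v a b assume va: "(v, a) \<in> parcs F" and vb: "(v, b) \<in> parcs F"
      and r: "(if v < 5 then v else 0) \<le> (if a < 5 then a else 0)"
        "(if v < 5 then v else 0) \<le> (if b < 5 then b else 0)"
    show "a = b"
    proof (cases "v < 5")
      case True
      have "v \<noteq> 0" "a \<noteq> 0" "b \<noteq> 0" using va vb by (auto simp: F_def)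
      moreover have "a = Suc v mod 5 \<or> a = (v + 4) mod 5 \<or> a = 5 + v"
        "b = Suc v mod 5 \<or> b = (v + 4) mod 5 \<or> b = 5 + v"
        using va vb sun5_arc_iff(1)[OF True] by (auto simp: F_def)
      ultimately have "a = Suc v" "b = Suc v"
        using r True by (auto simp: less_five)
      then show ?thesis by simp
    next
      case False
      then show ?thesis using pendant[OF va] pendant[OF vb] by simp
    qed
  qed
  obtain C where C: "path_cover F C" "card C = path_cover_number F"
    using path_cover_number_attained[OF F] by blast
  have "card {5..<10::nat} \<le> 2 * card C"
  proof (rule card_leaves_le_path_cover[OF C(1) pair_graphD(1)[OF F]])
    fix v a b assume "v \<in> {5..<10::nat}" "(v, a) \<in> parcs F" "(v, b) \<in> parcs F"
    then show "a = b" using pendant[of v a] pendant[of v b] by simp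
  qed (auto simp: F_def sun_def)
  then have P: "3 \<le> path_cover_number F" using C(2) by simp
  have "int (path_cover_number F) - int (card {0::nat}) \<le> T_minus (sun 5)"
    unfolding T_minus_def
    by (rule Max_ge[OF finite_deletion_sets[OF pair_graphD(1)[OF G]]])
      (use forest in \<open>auto simp: F_def sun_def intro!: exI[of _ "{0}"]\<close>)
  then show ?thesis using P by simp
qed

section \<open>The wheel on five vertices\<close>

text \<open>
  The wheel on five vertices is complete tripartite with parts \<open>{4}\<close>, \<open>{0, 2}\<close> and \<open>{1, 3}\<close>.
\<close>

lemma wheel5_arc_iff:
  "(u, v) \<in> parcs (wheel 5) \<longleftrightarrow> u < 5 \<and> v < 5 \<and> u \<noteq> v \<and> (u = 4 \<or> v = 4 \<or> odd (u + v))"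
proof (cases "u < 5 \<and> v < 5")
  case True
  then have "u = 0 \<or> u = 1 \<or> u = 2 \<or> u = 3 \<or> u = 4" "v = 0 \<or> v = 1 \<or> v = 2 \<or> v = 3 \<or> v = 4"
    unfolding less_five by simp_all
  then show ?thesis by (elim disjE; hypsubst; simp add: wheel_def cycle_arcs_def)
next
  case False
  then show ?thesis by (auto simp: wheel_def cycle_arcs_def)
qed

lemma pair_graph_wheel5: "pair_graph (wheel 5)"
  unfolding pair_graph_iff wheel5_arc_iff by (auto simp: wheel_def add.commute)

lemma max_multiplicity_wheel5_ge: "3 \<le> max_multiplicity (wheel 5)"
proof -
  define p where "p = (\<lambda>v::nat. if even v then 1 else 0 :: real)"
  define q where "q = (\<lambda>v::nat. if v = 4 \<or> odd v then 1 else 0 :: real)"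
  \<comment> \<open>A rank two form: even rim vertices, odd rim vertices and the hub are represented by the vectors
    \<open>(1, 0)\<close>, \<open>(0, 1)\<close> and \<open>(1, 1)\<close>, paired by \<open>x y' + y x'\<close>.\<close>
  define w where "w = (\<lambda>u v. p u * q v + q u * p v)"
  have V: "pverts (wheel 5) = {..<5}" by (simp add: wheel_def)
  have "weighting (wheel 5) w"
    unfolding weighting_def V wheel5_arc_iff by (auto simp: w_def p_def q_def)
  moreover have "nullity_ge (pverts (wheel 5)) w 3"
    unfolding V
  proof (rule nullity_geI)
    fix \<Phi> :: "(nat \<Rightarrow> real) set" assume fin: "finite \<Phi>" and card: "card \<Phi> < 3"
    have "card (insert p (insert q \<Phi>)) < card {..<5::nat}"
      using card fin by (simp add: card_insert_if)
    then obtain x where x: "\<exists>v \<in> {..<5}. x v \<noteq> 0"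
      "\<forall>\<phi> \<in> insert p (insert q \<Phi>). (\<Sum>v<5. \<phi> v * x v) = 0"
      using underdetermined_system[of "insert p (insert q \<Phi>)" "{..<5}"] fin by auto
    have "(\<Sum>v<5. w u v * x v) = p u * (\<Sum>v<5. q v * x v) + q u * (\<Sum>v<5. p v * x v)" for u
      by (simp add: w_def sum_distrib_left distrib_right sum.distrib mult.assoc)
    then have "(\<Sum>v<5. w u v * x v) = 0" for u using x(2) by simp
    then show "\<exists>x. (\<exists>v\<in>{..<5}. x v \<noteq> 0) \<and> (\<forall>u\<in>{..<5}. (\<Sum>v<5. w u v * x v) = 0) \<and>
        (\<forall>\<phi>\<in>\<Phi>. (\<Sum>v<5. \<phi> v * x v) = 0)"
      using x by (intro exI[of _ x]) auto
  qed
  ultimately show ?thesis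
    using le_max_multiplicity_iff[OF pair_graphD(1)[OF pair_graph_wheel5] pair_graphD(4)[OF pair_graph_wheel5]]
    by blast
qed

lemma T_plus_wheel5_le: "T_plus (wheel 5) \<le> 3"
proof -
  note G = pair_graph_wheel5
  define F where "F = delete_verts (wheel 5) {0, 2}"
  have F: "pair_graph F" unfolding F_def by (rule pair_graph_delete_verts[OF G])
  have FV: "pverts F = {1, 3, 4}" by (auto simp: F_def wheel_def less_five)
  have arc: "(u, v) \<in> parcs F \<longleftrightarrow> (u, v) \<in> {(1, 4), (4, 1), (3, 4), (4, 3)}" for u v
    unfolding F_def delete_verts_simps wheel5_arc_iff by (auto simp: less_five)
  have forest: "is_forest F"
    by (rule is_forestI_rank[OF F, where r = id]) (auto simp: arc)
  have "path_list F [1, 4, 3]"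
    unfolding path_list_def by (auto simp: arc less_Suc_eq nth_Cons')
  then have "path_cover F {{1, 3, 4}}"
    unfolding path_cover_def induces_path_iff FV
    by (auto simp: partition_on_def intro!: exI[of _ "[1, 4, 3]"])
  then have "path_cover_number F \<le> 1"
    using path_cover_number_le[OF pair_graphD(1)[OF F]] by fastforce
  moreover have "T_plus (wheel 5) \<le> int (path_cover_number F) + int (card {0, 2 :: nat})"
    unfolding T_plus_def
    by (rule Min_le[OF finite_deletion_sets[OF pair_graphD(1)[OF G]]])
      (use forest in \<open>auto simp: F_def wheel_def intro!: exI[of _ "{0, 2}"]\<close>)
  ultimately show ?thesis by simp
qed

theorem mainTheorem5:
  shows "T_minus (sun 5) = int (max_multiplicity (sun 5)) \<and>
    int (max_multiplicity (wheel 5)) = T_plus (wheel 5) \<and>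
    (\<forall>G :: 'a pair_pre_digraph. pair_graph G \<longrightarrow>
       T_minus G \<le> int (max_multiplicity G) \<and> int (max_multiplicity G) \<le> T_plus G) \<and>
    (\<exists>G :: nat pair_pre_digraph. pair_graph G \<and> T_minus G = int (max_multiplicity G)) \<and>
    (\<exists>G :: nat pair_pre_digraph. pair_graph G \<and> int (max_multiplicity G) = T_plus G)"
proof -
  have S: "pair_graph (sun 5)" by (rule pair_graph_sun) simp
  have sun: "T_minus (sun 5) = int (max_multiplicity (sun 5))"
    using T_minus_le_max_multiplicity[OF S] T_minus_sun5_ge max_multiplicity_sun5_le by linarith
  have wheel: "int (max_multiplicity (wheel 5)) = T_plus (wheel 5)"
    using max_multiplicity_le_T_plus[OF pair_graph_wheel5] T_plus_wheel5_le max_multiplicity_wheel5_ge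
    by linarith
  show ?thesis
    using sun wheel S pair_graph_wheel5 T_minus_le_max_multiplicity max_multiplicity_le_T_plus
    by blast
qed

end
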